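(* Let $K$ be a field, let $I\subset S=K[Y_1,\dots,Y_r]$ be any monomial ideal and set $R=S/I$. Let $P$ be a monomial prime ideal in $R$. Then for all $i$, the local cohomology module $H_P^i(R)$ is tame.
   Context: A monomial prime ideal $P$ of $R=S/I$ is a prime ideal generated by the residue classes of some of the variables $Y_1,\dots,Y_r$; fix a set of variables whose residue classes generate $P$. $R$ is given the grading in which the residue classes of the chosen variables generating $P$ have degree $1$ and the residue classes of the remaining variables have degree $0$; the local cohomology modules $H^i_P(R)$ inherit this $\mathbb{Z}$-grading, and tameness refers to it. A graded module $N$ over a positively graded Noetherian ring is called tame if there exists an integer $j_0$ such that either $N_j=0$ for all $j\le j_0$, or $N_j\ne0$ for all $j\le j_0$. *)

theory Defs
  imports "HOL-Algebra.QuotRing" "HOL-Algebra.Module" "HOL-Library.Poly_Mapping"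
begin

section \<open>Polynomial rings, monomial ideals and residue class rings\<close>

text \<open>
  Exponent vectors are finitely supported functions on \<open>nat\<close>; the product of the library type of
  finitely supported functions on exponent vectors is convolution, that is, the product of
  polynomials. The polynomial ring in \<open>Y\<^sub>1, \<dots>, Y\<^sub>r\<close> consists of the elements that only involve
  variables with an index in \<open>{1..r}\<close>.
\<close>

definition exponents :: "nat \<Rightarrow> (nat \<Rightarrow>\<^sub>0 nat) set"
  where "exponents r = {m. Poly_Mapping.keys m \<subseteq> {1..r}}"

definition poly_ring :: "nat \<Rightarrow> ((nat \<Rightarrow>\<^sub>0 nat) \<Rightarrow>\<^sub>0 'k::field) ring"
  where "poly_ring r =
    \<lparr>carrier = {p. Poly_Mapping.keys p \<subseteq> exponents r}, mult = (*), one = 1, zero = 0, add = (+)\<rparr>"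

definition monomial :: "(nat \<Rightarrow>\<^sub>0 nat) \<Rightarrow> ((nat \<Rightarrow>\<^sub>0 nat) \<Rightarrow>\<^sub>0 'k::field)"
  where "monomial m = Poly_Mapping.single m 1"

definition variable :: "nat \<Rightarrow> ((nat \<Rightarrow>\<^sub>0 nat) \<Rightarrow>\<^sub>0 'k::field)"
  where "variable k = monomial (Poly_Mapping.single k 1)"

definition monomial_ideal :: "nat \<Rightarrow> ((nat \<Rightarrow>\<^sub>0 nat) \<Rightarrow>\<^sub>0 'k::field) set \<Rightarrow> bool"
  where "monomial_ideal r I \<longleftrightarrow> (\<exists>A \<subseteq> exponents r. I = genideal (poly_ring r) (monomial ` A))"

definition residue_var ::
    "nat \<Rightarrow> ((nat \<Rightarrow>\<^sub>0 nat) \<Rightarrow>\<^sub>0 'k::field) set \<Rightarrow> nat \<Rightarrow> ((nat \<Rightarrow>\<^sub>0 nat) \<Rightarrow>\<^sub>0 'k) set"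
  where "residue_var r I k = I +>\<^bsub>poly_ring r\<^esub> variable k"

text \<open>
  The grading of the residue class ring in which the classes of the variables with index in \<open>T\<close>
  have degree 1 and those of the other variables have degree 0. Each component contains the zero element.
\<close>

definition residue_grading ::
    "nat \<Rightarrow> ((nat \<Rightarrow>\<^sub>0 nat) \<Rightarrow>\<^sub>0 'k::field) set \<Rightarrow> nat set \<Rightarrow> int \<Rightarrow> ((nat \<Rightarrow>\<^sub>0 nat) \<Rightarrow>\<^sub>0 'k) set set"
  where "residue_grading r I T d =
    {I +>\<^bsub>poly_ring r\<^esub> p | p. p \<in> carrier (poly_ring r) \<and>
      (\<forall>m \<in> Poly_Mapping.keys p. int (\<Sum>t\<in>T. Poly_Mapping.lookup m t) = d)}"


section \<open>Localization at the powers of an element\<close>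

text \<open>
  The pair \<open>(a, m)\<close> stands for the fraction \<open>a / f\<^sup>m\<close>. The operations on classes are unions over all
  representatives; each such union is a union of one and the same class.
\<close>

definition loc_rel :: "('a, 'c) ring_scheme \<Rightarrow> 'a \<Rightarrow> (('a \<times> nat) \<times> ('a \<times> nat)) set"
  where "loc_rel R f = {((a, m), (b, n)) | a m b n. a \<in> carrier R \<and> b \<in> carrier R \<and>
    (\<exists>k. f [^]\<^bsub>R\<^esub> (k + n) \<otimes>\<^bsub>R\<^esub> a = f [^]\<^bsub>R\<^esub> (k + m) \<otimes>\<^bsub>R\<^esub> b)}"

definition fraction :: "('a, 'c) ring_scheme \<Rightarrow> 'a \<Rightarrow> 'a \<Rightarrow> nat \<Rightarrow> ('a \<times> nat) set"
  where "fraction R f a m = loc_rel R f `` {(a, m)}"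

definition localization :: "('a, 'c) ring_scheme \<Rightarrow> 'a \<Rightarrow> ('a, ('a \<times> nat) set) module"
  where "localization R f =
    \<lparr>carrier = {fraction R f a m | a m. a \<in> carrier R},
     mult = (\<lambda>X Y. \<Union>(a, m)\<in>X. \<Union>(b, n)\<in>Y. fraction R f (a \<otimes>\<^bsub>R\<^esub> b) (m + n)),
     one = fraction R f \<one>\<^bsub>R\<^esub> 0,
     zero = fraction R f \<zero>\<^bsub>R\<^esub> 0,
     add = (\<lambda>X Y. \<Union>(a, m)\<in>X. \<Union>(b, n)\<in>Y.
       fraction R f (f [^]\<^bsub>R\<^esub> n \<otimes>\<^bsub>R\<^esub> a \<oplus>\<^bsub>R\<^esub> f [^]\<^bsub>R\<^esub> m \<otimes>\<^bsub>R\<^esub> b) (m + n)),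
     smult = (\<lambda>r X. \<Union>(a, m)\<in>X. fraction R f (r \<otimes>\<^bsub>R\<^esub> a) m)\<rparr>"

text \<open>
  If \<open>f\<close> is homogeneous of degree \<open>e\<close> in the ring graded by \<open>G\<close>, the fraction \<open>a / f\<^sup>m\<close> with \<open>a\<close>
  homogeneous has degree \<open>deg a - m e\<close>.
\<close>

definition localization_grading ::
    "('a, 'c) ring_scheme \<Rightarrow> (int \<Rightarrow> 'a set) \<Rightarrow> 'a \<Rightarrow> int \<Rightarrow> int \<Rightarrow> ('a \<times> nat) set set"
  where "localization_grading R G f e d = {fraction R f a m | a m. a \<in> G (d + int m * e)}"


section \<open>The Cech complex and local cohomology\<close>

text \<open>
  Let \<open>y k\<close>, for \<open>k\<close> in a finite set \<open>T\<close>, be elements of a commutative ring \<open>R\<close>. The module of Cech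
  cochains of degree \<open>i\<close> is the direct sum, over the subsets \<open>F\<close> of \<open>T\<close> with \<open>i\<close> elements, of the
  localizations of \<open>R\<close> at the product of the \<open>y k\<close> with \<open>k \<in> F\<close>. The fields \<open>mult\<close> and \<open>one\<close> of the
  module records below carry no meaning.
\<close>

definition faces :: "nat set \<Rightarrow> nat \<Rightarrow> nat set set"
  where "faces T i = {F. F \<subseteq> T \<and> card F = i}"

definition face_loc ::
    "('a, 'c) ring_scheme \<Rightarrow> (nat \<Rightarrow> 'a) \<Rightarrow> nat set \<Rightarrow> ('a, ('a \<times> nat) set) module"
  where "face_loc R y F = localization R (finprod R y F)"

definition cech ::
    "('a, 'c) ring_scheme \<Rightarrow> (nat \<Rightarrow> 'a) \<Rightarrow> nat set \<Rightarrow> nat \<Rightarrow> ('a, nat set \<Rightarrow> ('a \<times> nat) set) module"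
  where "cech R y T i =
    \<lparr>carrier = (\<Pi>\<^sub>E F\<in>faces T i. carrier (face_loc R y F)),
     mult = undefined,
     one = undefined,
     zero = (\<lambda>F\<in>faces T i. \<zero>\<^bsub>face_loc R y F\<^esub>),
     add = (\<lambda>c c'. \<lambda>F\<in>faces T i. c F \<oplus>\<^bsub>face_loc R y F\<^esub> c' F),
     smult = (\<lambda>r c. \<lambda>F\<in>faces T i. r \<odot>\<^bsub>face_loc R y F\<^esub> c F)\<rparr>"

text \<open>
  For \<open>k \<in> F\<close>, the canonical map from the localization belonging to \<open>F - {k}\<close> to the one belonging to
  \<open>F\<close> extends the fraction \<open>a / g\<^sup>m\<close> by \<open>(y k)\<^sup>m\<close>.
\<close>

definition face_map ::
    "('a, 'c) ring_scheme \<Rightarrow> (nat \<Rightarrow> 'a) \<Rightarrow> nat set \<Rightarrow> nat \<Rightarrow> ('a \<times> nat) set \<Rightarrow> ('a \<times> nat) set"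
  where "face_map R y F k X = (\<Union>(a, m)\<in>X. fraction R (finprod R y F) (y k [^]\<^bsub>R\<^esub> m \<otimes>\<^bsub>R\<^esub> a) m)"

definition cech_diff ::
    "('a, 'c) ring_scheme \<Rightarrow> (nat \<Rightarrow> 'a) \<Rightarrow> nat set \<Rightarrow> nat \<Rightarrow>
      (nat set \<Rightarrow> ('a \<times> nat) set) \<Rightarrow> (nat set \<Rightarrow> ('a \<times> nat) set)"
  where "cech_diff R y T i c =
    (\<lambda>F\<in>faces T (Suc i). finsum (face_loc R y F)
      (\<lambda>k. [((-1 :: int) ^ card {l \<in> F. l < k})] \<cdot>\<^bsub>face_loc R y F\<^esub> (face_map R y F k (c (F - {k})))) F)"

definition cocycles ::
    "('a, 'c) ring_scheme \<Rightarrow> (nat \<Rightarrow> 'a) \<Rightarrow> nat set \<Rightarrow> nat \<Rightarrow> (nat set \<Rightarrow> ('a \<times> nat) set) set"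
  where "cocycles R y T i = a_kernel (cech R y T i) (cech R y T (Suc i)) (cech_diff R y T i)"

fun coboundaries ::
    "('a, 'c) ring_scheme \<Rightarrow> (nat \<Rightarrow> 'a) \<Rightarrow> nat set \<Rightarrow> nat \<Rightarrow> (nat set \<Rightarrow> ('a \<times> nat) set) set"
  where
    "coboundaries R y T 0 = {\<zero>\<^bsub>cech R y T 0\<^esub>}"
  | "coboundaries R y T (Suc i) = cech_diff R y T i ` carrier (cech R y T i)"

definition cocycle_module ::
    "('a, 'c) ring_scheme \<Rightarrow> (nat \<Rightarrow> 'a) \<Rightarrow> nat set \<Rightarrow> nat \<Rightarrow> ('a, nat set \<Rightarrow> ('a \<times> nat) set) module"
  where "cocycle_module R y T i = (cech R y T i)\<lparr>carrier := cocycles R y T i\<rparr>"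

text \<open>
  The \<open>i\<close>-th local cohomology module of \<open>R\<close> with respect to the ideal generated by the \<open>y k\<close>,
  \<open>k \<in> T\<close>: the \<open>R\<close>-module of cocycles modulo coboundaries.
\<close>

definition local_cohomology ::
    "('a, 'c) ring_scheme \<Rightarrow> (nat \<Rightarrow> 'a) \<Rightarrow> nat set \<Rightarrow> nat \<Rightarrow>
      ('a, (nat set \<Rightarrow> ('a \<times> nat) set) set) module"
  where "local_cohomology R y T i =
    (let Z = cocycle_module R y T i; B = coboundaries R y T i in
      \<lparr>carrier = a_rcosets\<^bsub>Z\<^esub> B,
       mult = undefined,
       one = undefined,
       zero = B,
       add = set_add Z,
       smult = (\<lambda>r X. \<Union>z\<in>X. B +>\<^bsub>Z\<^esub> (r \<odot>\<^bsub>Z\<^esub> z))\<rparr>)"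

text \<open>
  The grading induced by a grading \<open>G\<close> of \<open>R\<close> for which every \<open>y k\<close> with \<open>k \<in> T\<close> has degree 1, so
  that the product over a face with \<open>i\<close> elements has degree \<open>i\<close>.
\<close>

definition cech_grading ::
    "('a, 'c) ring_scheme \<Rightarrow> (int \<Rightarrow> 'a set) \<Rightarrow> (nat \<Rightarrow> 'a) \<Rightarrow> nat set \<Rightarrow> nat \<Rightarrow> int \<Rightarrow>
      (nat set \<Rightarrow> ('a \<times> nat) set) set"
  where "cech_grading R G y T i d =
    (\<Pi>\<^sub>E F\<in>faces T i. localization_grading R G (finprod R y F) (int i) d)"

definition local_cohomology_grading ::
    "('a, 'c) ring_scheme \<Rightarrow> (int \<Rightarrow> 'a set) \<Rightarrow> (nat \<Rightarrow> 'a) \<Rightarrow> nat set \<Rightarrow> nat \<Rightarrow> int \<Rightarrow>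
      (nat set \<Rightarrow> ('a \<times> nat) set) set set"
  where "local_cohomology_grading R G y T i d =
    {coboundaries R y T i +>\<^bsub>cocycle_module R y T i\<^esub> z | z.
      z \<in> cocycles R y T i \<inter> cech_grading R G y T i d}"


section \<open>Tameness\<close>

text \<open>\<open>N\<^sub>d\<close> is the homogeneous component \<open>Gr d\<close> of the graded module \<open>N\<close>.\<close>

definition tame :: "('a, 'b, 'c) module_scheme \<Rightarrow> (int \<Rightarrow> 'b set) \<Rightarrow> bool"
  where "tame N Gr \<longleftrightarrow> (\<exists>j0 :: int.
    (\<forall>j \<le> j0. Gr j = {\<zero>\<^bsub>N\<^esub>}) \<or> (\<forall>j \<le> j0. Gr j \<noteq> {\<zero>\<^bsub>N\<^esub>}))"

end

theory Submission
  imports Defs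
begin

text \<open>
  The Cech complex of \<open>R = S / I\<close> is graded by integral exponent vectors \<open>a\<close>: each localization
  \<open>R\<^sub>F\<close> is \<open>K\<close> or \<open>0\<close> in the multidegree \<open>a\<close>. If \<open>a k < 0\<close>, whether it is \<open>K\<close> does not change when
  \<open>a k\<close> decreases by one, so multiplication by \<open>Y\<^sub>k\<close> identifies the strands of the complex in
  multidegrees \<open>a - e\<^sub>k\<close> and \<open>a\<close>. A multidegree of total degree \<open>j < 0\<close> in the variables from \<open>T\<close> has a
  negative entry in \<open>T\<close>; hence nonzero cohomology in degree \<open>j < 0\<close> forces nonzero cohomology in
  degree \<open>j - 1\<close>, and so in all smaller degrees.
\<close>

section \<open>Residue class rings of monomial ideals\<close>

text \<open>A homogeneous cocycle of total degree j may live in several multidegrees, with negative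
  entries at different variables, so no single variable divides all of it. The cohomology is not
  split into strands. Instead, a variable is chosen for each multidegree as a function of the
  multidegree alone; since the differential does not mix multidegrees, primitives found for
  different variables can be glued multidegree by multidegree.

  To make multidegrees visible, each fraction is replaced by the finitely supported function of its
  coefficients. Injectivity is where localization enters: a fraction vanishes exactly when a power
  of the denominator pushes all exponents of its numerator into the exponent set of I, and one power
  suffices because numerators have finitely many terms. Surjectivity is what turns primitives built
  as functions back into Cech cochains.\<close>

lemma exponents_add: "a \<in> exponents r \<Longrightarrow> b \<in> exponents r \<Longrightarrow> a + b \<in> exponents r"
  unfolding exponents_def using keys_add[of a b] by auto

lemma poly_ring_simps [simp]:
  "carrier (poly_ring r) = {p. Poly_Mapping.keys p \<subseteq> exponents r}"
  "mult (poly_ring r) = (*)" "one (poly_ring r) = 1" "zero (poly_ring r) = 0" "add (poly_ring r) = (+)"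
  by (simp_all add: poly_ring_def)

lemma cring_poly_ring: "cring (poly_ring r :: ((nat \<Rightarrow>\<^sub>0 nat) \<Rightarrow>\<^sub>0 'k::field) ring)"
proof (rule cringI)
  show "abelian_group (poly_ring r :: ((nat \<Rightarrow>\<^sub>0 nat) \<Rightarrow>\<^sub>0 'k) ring)"
  proof (rule abelian_groupI)
    fix x :: "(nat \<Rightarrow>\<^sub>0 nat) \<Rightarrow>\<^sub>0 'k" assume "x \<in> carrier (poly_ring r)"
    then show "\<exists>y\<in>carrier (poly_ring r). y \<oplus>\<^bsub>poly_ring r\<^esub> x = \<zero>\<^bsub>poly_ring r\<^esub>"
      by (intro bexI[of _ "- x"]) (auto simp: in_keys_iff)
  next
    fix x y :: "(nat \<Rightarrow>\<^sub>0 nat) \<Rightarrow>\<^sub>0 'k"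
    assume "x \<in> carrier (poly_ring r)" "y \<in> carrier (poly_ring r)"
    then show "x \<oplus>\<^bsub>poly_ring r\<^esub> y \<in> carrier (poly_ring r)"
      using keys_add[of x y] by auto
  qed (simp_all add: algebra_simps)
  show "comm_monoid (poly_ring r :: ((nat \<Rightarrow>\<^sub>0 nat) \<Rightarrow>\<^sub>0 'k) ring)"
  proof (rule comm_monoidI)
    fix x y :: "(nat \<Rightarrow>\<^sub>0 nat) \<Rightarrow>\<^sub>0 'k"
    assume "x \<in> carrier (poly_ring r)" "y \<in> carrier (poly_ring r)"
    then show "x \<otimes>\<^bsub>poly_ring r\<^esub> y \<in> carrier (poly_ring r)"
      using keys_mult[of x y] exponents_add by fastforce
  qed (auto simp: algebra_simps exponents_def)
qed (auto simp: algebra_simps)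

section \<open>Multiplication by a single monomial\<close>

lemma lookup_single_mult:
  fixes a b :: "nat \<Rightarrow>\<^sub>0 nat"
  shows "Poly_Mapping.lookup (Poly_Mapping.single a (1::'k::comm_ring_1) * p) (a + b) = Poly_Mapping.lookup p b"
proof -
  have "Poly_Mapping.lookup (Poly_Mapping.single a 1 * p) (a + b) =
      (\<Sum>l. (1 when a = l) * (\<Sum>q. Poly_Mapping.lookup p q when a + b = l + q))"
    by (simp add: lookup_mult lookup_single prod_fun_def)
  also have "\<dots> = (\<Sum>l. (\<Sum>q. Poly_Mapping.lookup p q when a + b = l + q) when l = a)"
    by (rule arg_cong[where f=Sum_any]) (auto simp: when_def)
  also have "\<dots> = Poly_Mapping.lookup p b"
    by simp
  finally show ?thesis .
qed

lemma lookup_single_mult_eq_0: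
  fixes a c :: "nat \<Rightarrow>\<^sub>0 nat"
  assumes "\<nexists>b. c = a + b"
  shows "Poly_Mapping.lookup (Poly_Mapping.single a (1::'k::comm_ring_1) * p) c = 0"
proof (rule ccontr)
  assume "\<not> ?thesis"
  then have "c \<in> Poly_Mapping.keys (Poly_Mapping.single a (1::'k) * p)"
    by (simp add: in_keys_iff)
  then show False
    using assms keys_mult[of "Poly_Mapping.single a (1::'k)" p] by auto
qed

lemma poly_eq_sum_singles: "p = (\<Sum>b\<in>Poly_Mapping.keys p. Poly_Mapping.single b (Poly_Mapping.lookup p b))"
  by (rule poly_mapping_eqI) (auto simp: lookup_sum lookup_single when_def in_keys_iff)

section \<open>Ideals spanned by monomials\<close>

lemma ideal_monomial_span:
  fixes M :: "(nat \<Rightarrow>\<^sub>0 nat) set"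
  assumes "M \<subseteq> exponents r" and "\<And>a b. a \<in> M \<Longrightarrow> b \<in> exponents r \<Longrightarrow> a + b \<in> M"
  shows "ideal {p :: (nat \<Rightarrow>\<^sub>0 nat) \<Rightarrow>\<^sub>0 'k::field. Poly_Mapping.keys p \<subseteq> M} (poly_ring r)" (is "ideal ?J _")
proof -
  interpret cring "poly_ring r :: ((nat \<Rightarrow>\<^sub>0 nat) \<Rightarrow>\<^sub>0 'k) ring"
    by (rule cring_poly_ring)
  have neg: "\<ominus>\<^bsub>poly_ring r\<^esub> p = - p" if "Poly_Mapping.keys p \<subseteq> exponents r" for p :: "(nat \<Rightarrow>\<^sub>0 nat) \<Rightarrow>\<^sub>0 'k"
    using that by (intro minus_equality) (auto simp: in_keys_iff)
  have mult: "x * p \<in> ?J" if "p \<in> ?J" "Poly_Mapping.keys x \<subseteq> exponents r" for x p :: "(nat \<Rightarrow>\<^sub>0 nat) \<Rightarrow>\<^sub>0 'k"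
    using keys_mult[of p x] that assms(2) by (fastforce simp: mult.commute)
  show ?thesis
  proof (rule idealI)
    show "subgroup ?J (add_monoid (poly_ring r))"
    proof (rule add.subgroupI)
      show "?J \<subseteq> carrier (poly_ring r)"
        using assms(1) by auto
      show "?J \<noteq> {}"
        by (auto intro!: exI[of _ 0])
      show "\<ominus>\<^bsub>poly_ring r\<^esub> p \<in> ?J" if "p \<in> ?J" for p
        using that assms(1) neg[of p] by (auto simp: in_keys_iff)
      show "p \<oplus>\<^bsub>poly_ring r\<^esub> q \<in> ?J" if "p \<in> ?J" "q \<in> ?J" for p q
        using that keys_add[of p q] by auto
    qed
  qed (use mult in \<open>auto simp: mult.commute ring_axioms\<close>)
qed

text \<open>Here \<open>M\<close> collects the exponents of all multiples of the generating
  monomials. Membership in \<open>I\<close> becomes a condition on supports, and everything later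
  about \<open>I\<close> is read off from \<open>M\<close>.\<close>

lemma monomial_ideal_span:
  assumes "monomial_ideal r (I :: ((nat \<Rightarrow>\<^sub>0 nat) \<Rightarrow>\<^sub>0 'k::field) set)"
  obtains M where "M \<subseteq> exponents r" "\<And>a b. a \<in> M \<Longrightarrow> b \<in> exponents r \<Longrightarrow> a + b \<in> M"
    "I = {p. Poly_Mapping.keys p \<subseteq> M}"
proof -
  obtain A where A: "A \<subseteq> exponents r" "I = genideal (poly_ring r) (monomial ` A)"
    using assms by (auto simp: monomial_ideal_def)
  define M where "M = {a + b | a b. a \<in> A \<and> b \<in> exponents r}"
  have M: "M \<subseteq> exponents r" "\<And>a b. a \<in> M \<Longrightarrow> b \<in> exponents r \<Longrightarrow> a + b \<in> M"
    using A(1) exponents_add by (auto simp: M_def) (metis add.assoc exponents_add)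
  interpret cring "poly_ring r :: ((nat \<Rightarrow>\<^sub>0 nat) \<Rightarrow>\<^sub>0 'k) ring"
    by (rule cring_poly_ring)
  have mon: "monomial ` A \<subseteq> carrier (poly_ring r :: ((nat \<Rightarrow>\<^sub>0 nat) \<Rightarrow>\<^sub>0 'k) ring)"
    using A(1) by (auto simp: monomial_def)
  interpret J: ideal I "poly_ring r"
    unfolding A(2) using mon by (rule genideal_ideal)
  have single: "Poly_Mapping.single c k \<in> I" if c: "c \<in> M" for c k
  proof -
    obtain a b where ab: "a \<in> A" "b \<in> exponents r" "c = a + b"
      using c by (auto simp: M_def)
    then have "monomial a \<in> I"
      unfolding A(2) using genideal_self[OF mon] by auto
    moreover have "Poly_Mapping.single b k \<in> carrier (poly_ring r)"
      using ab(2) by simp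
    ultimately have "monomial a * Poly_Mapping.single b k \<in> I"
      using J.I_r_closed by force
    then show ?thesis
      by (simp add: ab(3) monomial_def mult_single)
  qed
  have "I = {p. Poly_Mapping.keys p \<subseteq> M}"
  proof
    show "I \<subseteq> {p. Poly_Mapping.keys p \<subseteq> M}"
    proof -
      have "monomial ` A \<subseteq> {p :: (nat \<Rightarrow>\<^sub>0 nat) \<Rightarrow>\<^sub>0 'k. Poly_Mapping.keys p \<subseteq> M}"
        by (auto simp: monomial_def M_def exponents_def) (metis add.right_neutral empty_subsetI keys_zero)
      then show ?thesis
        unfolding A(2) using ideal_monomial_span[OF M] genideal_minimal by blast
    qed
    show "{p. Poly_Mapping.keys p \<subseteq> M} \<subseteq> I"
    proof
      fix p :: "(nat \<Rightarrow>\<^sub>0 nat) \<Rightarrow>\<^sub>0 'k" assume p: "p \<in> {p. Poly_Mapping.keys p \<subseteq> M}"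
      have "(\<Sum>b\<in>B. Poly_Mapping.single b (Poly_Mapping.lookup p b)) \<in> I" if "finite B" "B \<subseteq> Poly_Mapping.keys p" for B
        using that
      proof (induction B rule: finite_induct)
        case empty
        then show ?case using J.zero_closed by simp
      next
        case (insert b B)
        then have "Poly_Mapping.single b (Poly_Mapping.lookup p b) \<in> I" "(\<Sum>b\<in>B. Poly_Mapping.single b (Poly_Mapping.lookup p b)) \<in> I"
          using single p by auto
        then show ?case
          using insert.hyps J.a_closed by force
      qed
      then show "p \<in> I"
        using poly_eq_sum_singles by (metis finite_keys subset_refl)
    qed
  qed
  with M show ?thesis by (rule that)
qed

text \<open>The operations on localizations are unions over all representatives. Once a value is
  known not to depend on the representative, this collapses the union.\<close>

lemma UN_pair_const:
  assumes "z \<in> V" and "\<And>a m. (a, m) \<in> V \<Longrightarrow> h a m = c"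
  shows "(\<Union>(a, m)\<in>V. h a m) = c"
proof -
  have "(case x of (a, m) \<Rightarrow> h a m) = c" if "x \<in> V" for x
    using assms(2) that by (cases x) simp
  then show ?thesis
    using assms(1) by (intro SUP_eq_const) auto
qed

locale monomial_quotient =
  fixes r :: nat
    and M :: "(nat \<Rightarrow>\<^sub>0 nat) set"
    and I :: "((nat \<Rightarrow>\<^sub>0 nat) \<Rightarrow>\<^sub>0 'k::field) set"
  assumes M_exponents: "M \<subseteq> exponents r"
    and M_add: "a \<in> M \<Longrightarrow> b \<in> exponents r \<Longrightarrow> a + b \<in> M"
    and I_eq: "I = {p. Poly_Mapping.keys p \<subseteq> M}"
begin

abbreviation S :: "((nat \<Rightarrow>\<^sub>0 nat) \<Rightarrow>\<^sub>0 'k) ring" where "S \<equiv> poly_ring r"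
abbreviation R :: "((nat \<Rightarrow>\<^sub>0 nat) \<Rightarrow>\<^sub>0 'k) set ring" where "R \<equiv> S Quot I"
abbreviation y :: "nat \<Rightarrow> ((nat \<Rightarrow>\<^sub>0 nat) \<Rightarrow>\<^sub>0 'k) set" where "y \<equiv> residue_var r I"
abbreviation cls :: "((nat \<Rightarrow>\<^sub>0 nat) \<Rightarrow>\<^sub>0 'k) \<Rightarrow> ((nat \<Rightarrow>\<^sub>0 nat) \<Rightarrow>\<^sub>0 'k) set"
  where "cls p \<equiv> I +>\<^bsub>S\<^esub> p"
abbreviation mon :: "(nat \<Rightarrow>\<^sub>0 nat) \<Rightarrow> ((nat \<Rightarrow>\<^sub>0 nat) \<Rightarrow>\<^sub>0 'k) set"
  where "mon a \<equiv> cls (monomial a)"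

sublocale I: ideal I S
  unfolding I_eq using M_exponents M_add by (rule ideal_monomial_span)

sublocale R: cring R
  by (rule I.quotient_is_cring) (rule cring_poly_ring)

sublocale cls: ring_hom_cring S R cls
  by (rule I.rcos_ring_hom_cring) (rule cring_poly_ring)

text \<open>Two representatives of a class differ by a polynomial supported in \<open>M\<close>. The
  value 0 on \<open>M\<close> therefore makes the function independent of the chosen
  representative.\<close>

definition coef :: "((nat \<Rightarrow>\<^sub>0 nat) \<Rightarrow>\<^sub>0 'k) set \<Rightarrow> (nat \<Rightarrow>\<^sub>0 nat) \<Rightarrow> 'k"
  where "coef X b = (if b \<in> M then 0 else Poly_Mapping.lookup (SOME p. p \<in> X) b)"

lemma monomial_closed: "a \<in> exponents r \<Longrightarrow> monomial a \<in> carrier S"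
  by (simp add: monomial_def)

lemma coset_eq:
  assumes "p \<in> carrier S"
  shows "cls p = {q \<in> carrier S. \<forall>b. b \<notin> M \<longrightarrow> Poly_Mapping.lookup q b = Poly_Mapping.lookup p b}" (is "_ = ?C")
proof
  show "cls p \<subseteq> ?C"
  proof
    fix q assume "q \<in> cls p"
    then obtain h where h: "Poly_Mapping.keys h \<subseteq> M" "q = h + p"
      by (auto simp: a_r_coset_def' I_eq)
    then have "Poly_Mapping.keys q \<subseteq> exponents r"
      using keys_add[of h p] assms M_exponents by auto
    moreover have "Poly_Mapping.lookup h b = 0" if "b \<notin> M" for b
      using that h(1) by (auto simp: in_keys_iff)
    ultimately show "q \<in> ?C"
      by (simp add: h(2) lookup_add)
  qed
  show "?C \<subseteq> cls p"
  proof
    fix q assume q: "q \<in> ?C"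
    then have "Poly_Mapping.keys (q - p) \<subseteq> M"
      by (auto simp: in_keys_iff lookup_minus)
    then show "q \<in> cls p"
      by (auto simp: a_r_coset_def' I_eq intro!: exI[of _ "q - p"])
  qed
qed

lemma carrier_R_E:
  assumes "X \<in> carrier R"
  obtains p where "p \<in> carrier S" "X = cls p"
  using assms by (auto simp: FactRing_def A_RCOSETS_def')

lemma cls_closed: "p \<in> carrier S \<Longrightarrow> cls p \<in> carrier R"
  by (rule cls.hom_closed)

lemma coef_cls:
  assumes "p \<in> carrier S"
  shows "coef (cls p) b = (if b \<in> M then 0 else Poly_Mapping.lookup p b)"
proof -
  have "p \<in> cls p"
    using assms by (simp add: coset_eq)
  then have "(SOME q. q \<in> cls p) \<in> cls p"
    by (rule someI)
  then show ?thesis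
    using assms unfolding coef_def by (subst (asm) (2) coset_eq) auto
qed

lemma coef_inject:
  assumes "X \<in> carrier R" "Y \<in> carrier R" "\<And>b. coef X b = coef Y b"
  shows "X = Y"
proof -
  obtain p q where *: "p \<in> carrier S" "X = cls p" "q \<in> carrier S" "Y = cls q"
    using assms(1,2) carrier_R_E by metis
  have "Poly_Mapping.lookup p b = Poly_Mapping.lookup q b" if "b \<notin> M" for b
    using assms(3)[of b] that * by (simp add: coef_cls del: poly_ring_simps)
  then show ?thesis
    unfolding *(2,4) coset_eq[OF *(1)] coset_eq[OF *(3)] by auto
qed

lemma coef_exponents:
  assumes "X \<in> carrier R" "coef X b \<noteq> 0"
  shows "b \<in> exponents r"
proof -
  obtain p where "p \<in> carrier S" "X = cls p"
    using assms(1) by (rule carrier_R_E)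
  with assms(2) show ?thesis
    by (auto simp: coef_cls in_keys_iff split: if_splits)
qed

lemma finite_coef:
  assumes "X \<in> carrier R"
  shows "finite {b. coef X b \<noteq> 0}"
proof -
  obtain p where p: "p \<in> carrier S" "X = cls p"
    using assms by (rule carrier_R_E)
  have "{b. coef X b \<noteq> 0} \<subseteq> Poly_Mapping.keys p"
    using p by (auto simp: coef_cls in_keys_iff split: if_splits)
  then show ?thesis
    using finite_keys finite_subset by blast
qed

lemma coef_zero: "coef \<zero>\<^bsub>R\<^esub> b = 0"
  using coef_cls[of 0 b] cls.hom_zero by simp

lemma coef_add:
  assumes "X \<in> carrier R" "Y \<in> carrier R"
  shows "coef (X \<oplus>\<^bsub>R\<^esub> Y) b = coef X b + coef Y b"
proof -
  obtain p q where *: "p \<in> carrier S" "X = cls p" "q \<in> carrier S" "Y = cls q"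
    using assms carrier_R_E by metis
  then have "X \<oplus>\<^bsub>R\<^esub> Y = cls (p + q)" "p + q \<in> carrier S"
    using cls.hom_add[of p q] I.a_closed[of p q] by simp_all
  then show ?thesis
    by (simp add: *(2,4) coef_cls[OF *(1)] coef_cls[OF *(3)] coef_cls lookup_add del: poly_ring_simps)
qed

lemma coef_uminus:
  assumes "X \<in> carrier R"
  shows "coef (\<ominus>\<^bsub>R\<^esub> X) b = - coef X b"
proof -
  have "coef (\<ominus>\<^bsub>R\<^esub> X) b + coef X b = coef (\<ominus>\<^bsub>R\<^esub> X \<oplus>\<^bsub>R\<^esub> X) b"
    using assms by (intro coef_add[symmetric] R.a_inv_closed)
  then show ?thesis
    by (simp only: R.l_neg[OF assms] coef_zero eq_neg_iff_add_eq_0)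
qed

lemma mon_mult_cls:
  assumes "a \<in> exponents r" "p \<in> carrier S"
  shows "mon a \<otimes>\<^bsub>R\<^esub> cls p = cls (monomial a * p)" "monomial a * p \<in> carrier S"
  using cls.hom_mult[of "monomial a" p] I.m_closed[of "monomial a" p] assms monomial_closed by simp_all

lemma mon_closed: "a \<in> exponents r \<Longrightarrow> mon a \<in> carrier R"
  by (intro cls_closed monomial_closed)

lemma coef_mon_mult:
  assumes "a \<in> exponents r" "X \<in> carrier R"
  shows "coef (mon a \<otimes>\<^bsub>R\<^esub> X) (a + b) = (if a + b \<in> M then 0 else coef X b)"
proof -
  obtain p where p: "p \<in> carrier S" "X = cls p"
    using assms(2) by (rule carrier_R_E)
  have "a + b \<in> M" if "b \<in> M"
    using M_add[OF that assms(1)] by (simp add: add.commute)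
  then show ?thesis
    using mon_mult_cls[OF assms(1) p(1)] p(1)
    by (simp add: p(2) coef_cls monomial_def lookup_single_mult del: poly_ring_simps)
qed

lemma coef_mon_mult_eq_0:
  assumes "a \<in> exponents r" "X \<in> carrier R" "\<nexists>b. c = a + b"
  shows "coef (mon a \<otimes>\<^bsub>R\<^esub> X) c = 0"
proof -
  obtain p where p: "p \<in> carrier S" "X = cls p"
    using assms(2) by (rule carrier_R_E)
  show ?thesis
    using mon_mult_cls[OF assms(1) p(1)]
    by (simp add: p(2) coef_cls monomial_def lookup_single_mult_eq_0[OF assms(3)] del: poly_ring_simps)
qed

lemma mon_mult:
  assumes "a \<in> exponents r" "b \<in> exponents r"
  shows "mon a \<otimes>\<^bsub>R\<^esub> mon b = mon (a + b)"
  using mon_mult_cls(1)[OF assms(1) monomial_closed[OF assms(2)]] by (simp add: monomial_def mult_single)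

lemma mon_zero: "mon 0 = \<one>\<^bsub>R\<^esub>"
  using cls.hom_one by (simp add: monomial_def)

text \<open>The exponent vector of the \<open>n\<close>-th power of the product of the variables
  with index in \<open>F\<close>; these monomials are the denominators in the localization belonging
  to \<open>F\<close>.\<close>

definition face_exp :: "nat set \<Rightarrow> nat \<Rightarrow> (nat \<Rightarrow>\<^sub>0 nat)"
  where "face_exp F n = (\<Sum>k\<in>F. Poly_Mapping.single k n)"

lemma lookup_face_exp: "finite F \<Longrightarrow> Poly_Mapping.lookup (face_exp F n) k = (if k \<in> F then n else 0)"
  by (simp add: face_exp_def lookup_sum lookup_single when_def)

lemma exponents_iff: "a \<in> exponents r \<longleftrightarrow> (\<forall>k. k \<notin> {1..r} \<longrightarrow> Poly_Mapping.lookup a k = 0)"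
  by (auto simp: exponents_def in_keys_iff)

lemma face_exp_exponents: "F \<subseteq> {1..r} \<Longrightarrow> face_exp F n \<in> exponents r"
  using finite_subset[of F "{1..r}"] by (auto simp: exponents_iff lookup_face_exp)

lemma face_exp_add: "face_exp F m + face_exp F n = face_exp F (m + n)"
  by (simp add: face_exp_def single_add sum.distrib)

lemma face_exp_singleton: "face_exp {k} n = Poly_Mapping.single k n"
  by (simp add: face_exp_def)

lemma finprod_y:
  assumes "F \<subseteq> {1..r}"
  shows "finprod R y F = mon (face_exp F 1)"
  using finite_subset[OF assms finite_atLeastAtMost] assms
proof (induction F rule: finite_induct)
  case empty
  then show ?case by (simp add: face_exp_def mon_zero)
next
  case (insert k F)
  have y: "y l = mon (face_exp {l} 1)" for l
    by (simp add: residue_var_def variable_def face_exp_singleton)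
  have "y \<in> F \<rightarrow> carrier R" "y k \<in> carrier R"
    unfolding y[abs_def] using insert.prems by (auto intro!: mon_closed face_exp_exponents)
  then have "finprod R y (insert k F) = y k \<otimes>\<^bsub>R\<^esub> finprod R y F"
    using insert.hyps by simp
  also have "\<dots> = mon (face_exp {k} 1) \<otimes>\<^bsub>R\<^esub> mon (face_exp F 1)"
    using insert by (simp only: y[of k]) simp
  also have "\<dots> = mon (face_exp {k} 1 + face_exp F 1)"
    using insert.prems by (intro mon_mult face_exp_exponents) auto
  also have "face_exp {k} 1 + face_exp F 1 = face_exp (insert k F) 1"
    using insert.hyps by (simp add: face_exp_def)
  finally show ?case .
qed

lemma mon_face_pow:
  fixes n :: nat
  assumes "F \<subseteq> {1..r}"
  shows "mon (face_exp F 1) [^]\<^bsub>R\<^esub> n = mon (face_exp F n)"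
proof (induction n)
  case 0
  then show ?case by (simp add: face_exp_def mon_zero)
next
  case (Suc n)
  then show ?case
    using mon_mult[OF face_exp_exponents face_exp_exponents, OF assms assms] by (simp add: face_exp_add)
qed

lemma y_pow:
  fixes n :: nat
  shows "k \<in> {1..r} \<Longrightarrow> y k [^]\<^bsub>R\<^esub> n = mon (Poly_Mapping.single k n)"
  using mon_face_pow[of "{k}" n] by (simp add: residue_var_def variable_def face_exp_singleton)

section \<open>Multidegrees of fractions\<close>

text \<open>A term of multidegree \<open>a\<close> in a fraction with denominator exponent
  \<open>m\<close> has this exponent in the numerator: the entries in \<open>F\<close> are raised by
  \<open>m\<close>. The truncation \<open>nat\<close> is faithful only if no raised entry is
  negative, hence the side conditions \<open>0 \<le> a k + int m\<close> in later
  statements.\<close>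

definition expo :: "nat set \<Rightarrow> nat \<Rightarrow> (nat \<Rightarrow> int) \<Rightarrow> (nat \<Rightarrow>\<^sub>0 nat)"
  where "expo F m a = (\<Sum>k\<in>{1..r}. Poly_Mapping.single k (nat (a k + (if k \<in> F then int m else 0))))"

text \<open>
  The localization at the product of the \<open>Y\<^sub>k\<close>, \<open>k \<in> F\<close>, is nonzero precisely in the multidegrees
  from \<open>degrees F\<close>; \<open>frac_coef F X m a\<close> is the coefficient in multidegree \<open>a\<close> of the fraction \<open>(X, m)\<close>.
\<close>

definition degrees :: "nat set \<Rightarrow> (nat \<Rightarrow> int) set"
  where "degrees F = {a. (\<forall>k. k \<notin> {1..r} \<longrightarrow> a k = 0) \<and> (\<forall>k. k \<notin> F \<longrightarrow> 0 \<le> a k) \<and>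
    (\<forall>N. (\<forall>k\<in>F. 0 \<le> a k + int N) \<longrightarrow> expo F N a \<notin> M)}"

definition frac_coef :: "nat set \<Rightarrow> ((nat \<Rightarrow>\<^sub>0 nat) \<Rightarrow>\<^sub>0 'k) set \<Rightarrow> nat \<Rightarrow> (nat \<Rightarrow> int) \<Rightarrow> 'k"
  where "frac_coef F X m a =
    (if a \<in> degrees F \<and> (\<forall>k\<in>F. 0 \<le> a k + int m) then coef X (expo F m a) else 0)"

lemma lookup_expo:
  "Poly_Mapping.lookup (expo F m a) k = (if k \<in> {1..r} then nat (a k + (if k \<in> F then int m else 0)) else 0)"
  by (simp add: expo_def lookup_sum lookup_single when_def)

lemma expo_exponents: "expo F m a \<in> exponents r"
  by (simp add: exponents_iff lookup_expo)

lemma expo_add: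
  assumes "F \<subseteq> {1..r}" "\<forall>k\<in>F. 0 \<le> a k + int m"
  shows "expo F (N + m) a = face_exp F N + expo F m a"
  using assms finite_subset[OF assms(1)]
  by (intro poly_mapping_eqI) (auto simp: lookup_expo lookup_add lookup_face_exp nat_add_distrib)

lemma degreesD:
  assumes "a \<in> degrees F"
  shows "k \<notin> {1..r} \<Longrightarrow> a k = 0" "k \<notin> F \<Longrightarrow> 0 \<le> a k"
    "(\<And>k. k \<in> F \<Longrightarrow> 0 \<le> a k + int N) \<Longrightarrow> expo F N a \<notin> M"
  using assms by (auto simp: degrees_def)

lemma expo_inject:
  assumes "a \<in> degrees F" "b \<in> degrees F" "\<forall>k\<in>F. 0 \<le> a k + int m" "\<forall>k\<in>F. 0 \<le> b k + int m"
    "expo F m a = expo F m b"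
  shows "a = b"
proof
  fix k
  have "Poly_Mapping.lookup (expo F m a) k = Poly_Mapping.lookup (expo F m b) k"
    using assms(5) by simp
  then show "a k = b k"
    using assms(3,4) degreesD(1,2)[OF assms(1), of k] degreesD(1,2)[OF assms(2), of k]
    by (cases "k \<in> {1..r}"; cases "k \<in> F") (force simp: lookup_expo eq_nat_nat_iff)+
qed

lemma frac_coef_extend:
  assumes "F \<subseteq> {1..r}" "X \<in> carrier R"
  shows "frac_coef F (mon (face_exp F N) \<otimes>\<^bsub>R\<^esub> X) (N + m) = frac_coef F X m"
proof
  fix a
  consider "a \<notin> degrees F" | "a \<in> degrees F" "\<forall>k\<in>F. 0 \<le> a k + int m"
    | k where "a \<in> degrees F" "k \<in> F" "a k + int m < 0"
    by fastforce
  then show "frac_coef F (mon (face_exp F N) \<otimes>\<^bsub>R\<^esub> X) (N + m) a = frac_coef F X m a"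
  proof cases
    case 1
    then show ?thesis by (simp add: frac_coef_def)
  next
    case 2
    then have nn: "\<forall>k\<in>F. 0 \<le> a k + int (N + m)"
      by fastforce
    then have "expo F (N + m) a \<notin> M"
      using degreesD(3)[OF 2(1)] by blast
    then show ?thesis
      using 2 nn coef_mon_mult[OF face_exp_exponents[OF assms(1)] assms(2), of N "expo F m a"]
      by (simp add: frac_coef_def expo_add[OF assms(1) 2(2)])
  next
    case 3
    \<comment> \<open>With the larger denominator exponent this multidegree may become
      representable, but its entry at \<open>k\<close> is then below \<open>N\<close>, so the
      exponent is not reached by multiplication with \<open>face_exp F N\<close>.\<close>
    have "coef (mon (face_exp F N) \<otimes>\<^bsub>R\<^esub> X) (expo F (N + m) a) = 0"
      if "\<forall>k\<in>F. 0 \<le> a k + int (N + m)"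
    proof (rule coef_mon_mult_eq_0[OF face_exp_exponents[OF assms(1)] assms(2)])
      show "\<nexists>b. expo F (N + m) a = face_exp F N + b"
      proof
        assume "\<exists>b. expo F (N + m) a = face_exp F N + b"
        then obtain b where "Poly_Mapping.lookup (expo F (N + m) a) k = Poly_Mapping.lookup (face_exp F N + b) k"
          by auto
        moreover have "k \<in> {1..r}" "finite F"
          using assms(1) 3(2) finite_subset by auto
        ultimately have "nat (a k + int (N + m)) \<ge> N"
          using 3(2) by (simp add: lookup_expo lookup_add lookup_face_exp)
        then show False
          using 3 that by auto
      qed
    qed
    then show ?thesis
      using 3 by (auto simp: frac_coef_def)
  qed
qed

text \<open>The numerators differ at finitely many exponents. An exponent that never enters
  \<open>M\<close> under powers of the denominator would give a multidegree in
  \<open>degrees F\<close> at which the fractions have different coefficients. So each difference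
  dies after some power, and finiteness gives one power for all.\<close>

lemma frac_coef_eq_iff_common:
  assumes "F \<subseteq> {1..r}" "X \<in> carrier R" "Y \<in> carrier R" "frac_coef F X m = frac_coef F Y m"
  shows "\<exists>N. mon (face_exp F N) \<otimes>\<^bsub>R\<^esub> X = mon (face_exp F N) \<otimes>\<^bsub>R\<^esub> Y"
proof -
  define B where "B = {b. coef X b \<noteq> coef Y b}"
  have "B \<subseteq> {b. coef X b \<noteq> 0} \<union> {b. coef Y b \<noteq> 0}"
    by (auto simp: B_def)
  then have fin: "finite B"
    using finite_coef[OF assms(2)] finite_coef[OF assms(3)] by (meson finite_UnI finite_subset)
  have fF: "finite F"
    using assms(1) finite_subset by blast
  have "\<exists>N. face_exp F N + b \<in> M" if b: "b \<in> B" for b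
  proof (rule ccontr)
    assume notM: "\<nexists>N. face_exp F N + b \<in> M"
    \<comment> \<open>The multidegree of the term \<open>b\<close> over the denominator exponent
      \<open>m\<close>.\<close>
    define a where "a k = int (Poly_Mapping.lookup b k) - (if k \<in> F then int m else 0)" for k
    have "b \<in> exponents r"
      using b coef_exponents assms(2,3) unfolding B_def by (metis (mono_tags) mem_Collect_eq)
    then have b0: "Poly_Mapping.lookup b k = 0" if "k \<notin> {1..r}" for k
      using that by (simp add: exponents_iff)
    have m: "\<forall>k\<in>F. 0 \<le> a k + int m"
      by (simp add: a_def)
    have expo_m: "expo F m a = b"
      using b0 by (intro poly_mapping_eqI) (auto simp: lookup_expo a_def)
    have "expo F N a \<notin> M" if N: "\<forall>k\<in>F. 0 \<le> a k + int N" for N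
    proof
      assume "expo F N a \<in> M"
      \<comment> \<open>\<open>N\<close> may be smaller than \<open>m\<close>, so
        \<open>expo F N a\<close> and \<open>b\<close> are compared only after extending both to the
        denominator exponent \<open>N + m\<close>.\<close>
      then have "face_exp F m + expo F N a \<in> M"
        using M_add[of "expo F N a" "face_exp F m"] face_exp_exponents[OF assms(1)] by (simp add: add.commute)
      moreover have "face_exp F m + expo F N a = face_exp F N + expo F m a"
        using expo_add[OF assms(1) N, of m] expo_add[OF assms(1) m, of N] by (simp add: add.commute)
      ultimately show False
        using notM expo_m by auto
    qed
    then have "a \<in> degrees F"
      using b0 assms(1) by (auto simp: degrees_def a_def)
    then have "frac_coef F X m a = coef X b" "frac_coef F Y m a = coef Y b"
      using expo_m by (auto simp: frac_coef_def a_def)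
    with assms(4) b show False
      by (simp add: B_def)
  qed
  then obtain n where n: "\<And>b. b \<in> B \<Longrightarrow> face_exp F (n b) + b \<in> M"
    by metis
  \<comment> \<open>The sum serves as a common upper bound of the individual powers.\<close>
  define N where "N = (\<Sum>b\<in>B. n b)"
  have in_M: "face_exp F N + b \<in> M" if "b \<in> B" for b
  proof -
    have "n b \<le> N"
      unfolding N_def using that fin by (intro member_le_sum) auto
    then obtain l where "N = n b + l"
      using le_Suc_ex by blast
    then have "face_exp F N + b = (face_exp F (n b) + b) + face_exp F l"
      by (simp add: face_exp_add[symmetric] ac_simps)
    then show ?thesis
      using M_add[OF n[OF that] face_exp_exponents[OF assms(1)]] by simp
  qed
  have closed: "mon (face_exp F N) \<otimes>\<^bsub>R\<^esub> Z \<in> carrier R" if "Z \<in> carrier R" for Z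
    using that mon_closed[OF face_exp_exponents[OF assms(1)]] by simp
  have "mon (face_exp F N) \<otimes>\<^bsub>R\<^esub> X = mon (face_exp F N) \<otimes>\<^bsub>R\<^esub> Y"
  proof (rule coef_inject[OF closed[OF assms(2)] closed[OF assms(3)]])
    fix c
    show "coef (mon (face_exp F N) \<otimes>\<^bsub>R\<^esub> X) c = coef (mon (face_exp F N) \<otimes>\<^bsub>R\<^esub> Y) c"
    proof (cases "\<exists>b. c = face_exp F N + b")
      case True
      then obtain b where "c = face_exp F N + b" ..
      then show ?thesis
        using in_M[of b] coef_mon_mult[OF face_exp_exponents[OF assms(1)]] assms(2,3)
        by (cases "b \<in> B") (auto simp: B_def)
    next
      case False
      then show ?thesis
        using coef_mon_mult_eq_0[OF face_exp_exponents[OF assms(1)]] assms(2,3) by simp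
    qed
  qed
  then show ?thesis ..
qed

text \<open>This embeds the localization into a space of functions: equality of fractions is tested
  coefficientwise. One direction extends both fractions to a common denominator exponent; the other
  then applies the finiteness argument for equal denominator exponents.\<close>

lemma loc_rel_iff:
  assumes "F \<subseteq> {1..r}"
  shows "((X, m), (Y, n)) \<in> loc_rel R (finprod R y F) \<longleftrightarrow>
    X \<in> carrier R \<and> Y \<in> carrier R \<and> frac_coef F X m = frac_coef F Y n"
proof -
  let ?f = "finprod R y F"
  have pow: "?f [^]\<^bsub>R\<^esub> N = mon (face_exp F N)" for N :: nat
    using mon_face_pow[OF assms] finprod_y[OF assms] by simp
  have mon: "mon (face_exp F N) \<in> carrier R" for N
    by (intro mon_closed face_exp_exponents assms)
  have "(\<exists>k. ?f [^]\<^bsub>R\<^esub> (k + n) \<otimes>\<^bsub>R\<^esub> X = ?f [^]\<^bsub>R\<^esub> (k + m) \<otimes>\<^bsub>R\<^esub> Y)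
      \<longleftrightarrow> frac_coef F X m = frac_coef F Y n" (is "?L \<longleftrightarrow> ?R")
    if X: "X \<in> carrier R" and Y: "Y \<in> carrier R"
  proof
    assume ?L
    then obtain k where k: "mon (face_exp F (k + n)) \<otimes>\<^bsub>R\<^esub> X = mon (face_exp F (k + m)) \<otimes>\<^bsub>R\<^esub> Y"
      by (auto simp: pow)
    have "frac_coef F X m = frac_coef F (mon (face_exp F (k + n)) \<otimes>\<^bsub>R\<^esub> X) (k + n + m)"
      using frac_coef_extend[OF assms X] by simp
    also have "\<dots> = frac_coef F (mon (face_exp F (k + m)) \<otimes>\<^bsub>R\<^esub> Y) (k + m + n)"
      by (simp only: k) (simp add: ac_simps)
    also have "\<dots> = frac_coef F Y n"
      using frac_coef_extend[OF assms Y] by simp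
    finally show ?R .
  next
    assume ?R
    then have "frac_coef F (mon (face_exp F n) \<otimes>\<^bsub>R\<^esub> X) (n + m) = frac_coef F (mon (face_exp F m) \<otimes>\<^bsub>R\<^esub> Y) (n + m)"
      using frac_coef_extend[OF assms X, of n m] frac_coef_extend[OF assms Y, of m n] by (simp add: add.commute)
    then obtain k where "mon (face_exp F k) \<otimes>\<^bsub>R\<^esub> (mon (face_exp F n) \<otimes>\<^bsub>R\<^esub> X) =
        mon (face_exp F k) \<otimes>\<^bsub>R\<^esub> (mon (face_exp F m) \<otimes>\<^bsub>R\<^esub> Y)"
      using frac_coef_eq_iff_common[OF assms] X Y mon by blast
    then have "mon (face_exp F (k + n)) \<otimes>\<^bsub>R\<^esub> X = mon (face_exp F (k + m)) \<otimes>\<^bsub>R\<^esub> Y"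
      using X Y mon mon_mult[OF face_exp_exponents face_exp_exponents, OF assms assms]
      by (simp add: R.m_assoc[symmetric] face_exp_add)
    then show ?L
      by (auto simp: pow)
  qed
  then show ?thesis
    by (auto simp: loc_rel_def)
qed

section \<open>The localizations as spaces of functions on multidegrees\<close>

abbreviation den :: "nat set \<Rightarrow> ((nat \<Rightarrow>\<^sub>0 nat) \<Rightarrow>\<^sub>0 'k) set" where "den F \<equiv> finprod R y F"
abbreviation L :: "nat set \<Rightarrow>
    (((nat \<Rightarrow>\<^sub>0 nat) \<Rightarrow>\<^sub>0 'k) set, (((nat \<Rightarrow>\<^sub>0 nat) \<Rightarrow>\<^sub>0 'k) set \<times> nat) set) module"
  where "L F \<equiv> face_loc R y F"

definition val :: "nat set \<Rightarrow> (((nat \<Rightarrow>\<^sub>0 nat) \<Rightarrow>\<^sub>0 'k) set \<times> nat) set \<Rightarrow> (nat \<Rightarrow> int) \<Rightarrow> 'k"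
  where "val F V = (case SOME z. z \<in> V of (X, m) \<Rightarrow> frac_coef F X m)"

lemma den_pow:
  fixes n :: nat
  shows "F \<subseteq> {1..r} \<Longrightarrow> den F [^]\<^bsub>R\<^esub> n = mon (face_exp F n)"
  by (simp only: finprod_y mon_face_pow)

lemma face_mon_closed: "F \<subseteq> {1..r} \<Longrightarrow> mon (face_exp F n) \<in> carrier R"
  by (intro mon_closed face_exp_exponents)

lemma fraction_eq:
  assumes "F \<subseteq> {1..r}" "X \<in> carrier R"
  shows "fraction R (den F) X m = {(Y, n). Y \<in> carrier R \<and> frac_coef F Y n = frac_coef F X m}"
  unfolding fraction_def Image_singleton using assms(2)
  by (intro Collect_cong) (auto simp: loc_rel_iff[OF assms(1)] split: prod.split)

lemma fraction_eqI:
  assumes "F \<subseteq> {1..r}" "X \<in> carrier R" "Y \<in> carrier R" "frac_coef F X m = frac_coef F Y n"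
  shows "fraction R (den F) X m = fraction R (den F) Y n"
  by (simp only: fraction_eq[OF assms(1,2)] fraction_eq[OF assms(1,3)] assms(4))

lemma fraction_self:
  "F \<subseteq> {1..r} \<Longrightarrow> X \<in> carrier R \<Longrightarrow> (X, m) \<in> fraction R (den F) X m"
  by (simp add: fraction_eq)

lemma val_fraction:
  assumes "F \<subseteq> {1..r}" "X \<in> carrier R"
  shows "val F (fraction R (den F) X m) = frac_coef F X m"
proof -
  have "(SOME z. z \<in> fraction R (den F) X m) \<in> fraction R (den F) X m"
    using fraction_self[OF assms] by (rule someI)
  then show ?thesis
    using assms by (auto simp: val_def fraction_eq)
qed

lemma carrier_L: "carrier (L F) = {fraction R (den F) X m | X m. X \<in> carrier R}"
  by (simp add: face_loc_def localization_def)

lemma carrier_L_E: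
  assumes "V \<in> carrier (L F)"
  obtains X m where "X \<in> carrier R" "V = fraction R (den F) X m"
  using assms unfolding carrier_L by blast

lemma fraction_closed: "X \<in> carrier R \<Longrightarrow> fraction R (den F) X m \<in> carrier (L F)"
  unfolding carrier_L by blast

lemma val_inject:
  assumes "F \<subseteq> {1..r}" "V \<in> carrier (L F)" "W \<in> carrier (L F)" "val F V = val F W"
  shows "V = W"
proof -
  obtain X m Y n where *: "X \<in> carrier R" "V = fraction R (den F) X m"
      "Y \<in> carrier R" "W = fraction R (den F) Y n"
    using assms(2,3) carrier_L_E by metis
  then have "frac_coef F X m = frac_coef F Y n"
    using assms(4) by (simp add: val_fraction[OF assms(1)])
  then show ?thesis
    unfolding *(2,4) by (rule fraction_eqI[OF assms(1) *(1,3)])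
qed

section \<open>Addition in a localization\<close>

lemma frac_coef_add:
  assumes "X \<in> carrier R" "Y \<in> carrier R"
  shows "frac_coef F (X \<oplus>\<^bsub>R\<^esub> Y) m a = frac_coef F X m a + frac_coef F Y m a"
  by (simp add: frac_coef_def coef_add[OF assms])

text \<open>Both conclusions rest on one computation: in the sum over a common denominator,
  coefficients add up. Applied to arbitrary representatives, it shows that the class of the sum is
  well defined, so that the union defining the sum collapses.\<close>

lemma L_add_fraction:
  assumes "F \<subseteq> {1..r}" "X \<in> carrier R" "Y \<in> carrier R"
  shows "fraction R (den F) X m \<oplus>\<^bsub>L F\<^esub> fraction R (den F) Y n =
      fraction R (den F) (mon (face_exp F n) \<otimes>\<^bsub>R\<^esub> X \<oplus>\<^bsub>R\<^esub> mon (face_exp F m) \<otimes>\<^bsub>R\<^esub> Y) (m + n)"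
    (is "_ = fraction R _ (?c X m Y n) _")
    and "frac_coef F (mon (face_exp F n) \<otimes>\<^bsub>R\<^esub> X \<oplus>\<^bsub>R\<^esub> mon (face_exp F m) \<otimes>\<^bsub>R\<^esub> Y) (m + n) a =
      frac_coef F X m a + frac_coef F Y n a"
proof -
  have fc: "frac_coef F (?c X m Y n) (m + n) a = frac_coef F X m a + frac_coef F Y n a"
    if "X \<in> carrier R" "Y \<in> carrier R" for X Y m n a
  proof -
    have "frac_coef F (?c X m Y n) (m + n) a =
        frac_coef F (mon (face_exp F n) \<otimes>\<^bsub>R\<^esub> X) (n + m) a + frac_coef F (mon (face_exp F m) \<otimes>\<^bsub>R\<^esub> Y) (m + n) a"
      using that face_mon_closed[OF assms(1)] by (simp add: frac_coef_add add.commute)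
    then show ?thesis
      using frac_coef_extend[OF assms(1)] that by simp
  qed
  then show "frac_coef F (?c X m Y n) (m + n) a = frac_coef F X m a + frac_coef F Y n a"
    using assms by simp
  have closed: "?c X m Y n \<in> carrier R" if "X \<in> carrier R" "Y \<in> carrier R" for X Y m n
    using that face_mon_closed[OF assms(1)] by simp
  have "fraction R (den F) (?c X' m' Y' n') (m' + n') = fraction R (den F) (?c X m Y n) (m + n)"
    if "(X', m') \<in> fraction R (den F) X m" "(Y', n') \<in> fraction R (den F) Y n" for X' m' Y' n'
  proof (rule fraction_eqI[OF assms(1) closed closed])
    show *: "X' \<in> carrier R" "Y' \<in> carrier R"
      using that assms by (auto simp: fraction_eq)
    show "frac_coef F (?c X' m' Y' n') (m' + n') = frac_coef F (?c X m Y n) (m + n)"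
      using that assms * by (intro ext) (simp add: fc fraction_eq)
  qed (use assms in auto)
  then have "(\<Union>(X', m')\<in>fraction R (den F) X m. \<Union>(Y', n')\<in>fraction R (den F) Y n.
      fraction R (den F) (?c X' m' Y' n') (m' + n')) = fraction R (den F) (?c X m Y n) (m + n)"
    by (intro UN_pair_const[OF fraction_self[OF assms(1,2)]] UN_pair_const[OF fraction_self[OF assms(1,3)]])
  then show "fraction R (den F) X m \<oplus>\<^bsub>L F\<^esub> fraction R (den F) Y n = fraction R (den F) (?c X m Y n) (m + n)"
    by (simp only: face_loc_def localization_def ring_record_simps den_pow[OF assms(1)])
qed

lemma L_add:
  assumes "F \<subseteq> {1..r}" "V \<in> carrier (L F)" "W \<in> carrier (L F)"
  shows L_add_closed: "V \<oplus>\<^bsub>L F\<^esub> W \<in> carrier (L F)"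
    and val_add: "val F (V \<oplus>\<^bsub>L F\<^esub> W) a = val F V a + val F W a"
proof -
  obtain X m Y n where *: "X \<in> carrier R" "V = fraction R (den F) X m"
      "Y \<in> carrier R" "W = fraction R (den F) Y n"
    using assms(2,3) carrier_L_E by metis
  have closed: "mon (face_exp F n) \<otimes>\<^bsub>R\<^esub> X \<oplus>\<^bsub>R\<^esub> mon (face_exp F m) \<otimes>\<^bsub>R\<^esub> Y \<in> carrier R"
    using * face_mon_closed[OF assms(1)] by simp
  show "V \<oplus>\<^bsub>L F\<^esub> W \<in> carrier (L F)"
    unfolding *(2,4) L_add_fraction(1)[OF assms(1) *(1,3)] using closed by (rule fraction_closed)
  show "val F (V \<oplus>\<^bsub>L F\<^esub> W) a = val F V a + val F W a"
    unfolding *(2,4) L_add_fraction(1)[OF assms(1) *(1,3)]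
    using closed * by (simp add: val_fraction[OF assms(1)] L_add_fraction(2)[OF assms(1)])
qed

lemma L_zero:
  assumes "F \<subseteq> {1..r}"
  shows L_zero_closed: "\<zero>\<^bsub>L F\<^esub> \<in> carrier (L F)" and val_zero: "val F \<zero>\<^bsub>L F\<^esub> a = 0"
proof -
  have *: "\<zero>\<^bsub>L F\<^esub> = fraction R (den F) \<zero>\<^bsub>R\<^esub> 0"
    by (simp add: face_loc_def localization_def)
  show "\<zero>\<^bsub>L F\<^esub> \<in> carrier (L F)"
    unfolding * by (intro fraction_closed R.zero_closed)
  show "val F \<zero>\<^bsub>L F\<^esub> a = 0"
    unfolding * val_fraction[OF assms R.zero_closed] by (simp add: frac_coef_def coef_zero)
qed

text \<open>\<open>val\<close> is additive and injective, so the group laws are checked on functions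
  with values in the field. The group structure gives meaning to the signed sums in the Cech
  differential.\<close>

lemma abelian_group_L:
  assumes "F \<subseteq> {1..r}"
  shows "abelian_group (L F)"
proof (rule abelian_groupI)
  note simps = L_add_closed[OF assms] val_add[OF assms] L_zero[OF assms]
  note inj = val_inject[OF assms]
  show "\<exists>W\<in>carrier (L F). W \<oplus>\<^bsub>L F\<^esub> V = \<zero>\<^bsub>L F\<^esub>" if V: "V \<in> carrier (L F)" for V
  proof -
    obtain X m where X: "X \<in> carrier R" "V = fraction R (den F) X m"
      using V by (rule carrier_L_E)
    let ?W = "fraction R (den F) (\<ominus>\<^bsub>R\<^esub> X) m"
    have W: "?W \<in> carrier (L F)"
      using X by (intro fraction_closed R.a_inv_closed)
    moreover have "val F (?W \<oplus>\<^bsub>L F\<^esub> V) = val F \<zero>\<^bsub>L F\<^esub>"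
      using X(1) W V by (intro ext) (simp add: simps X(2) val_fraction[OF assms] frac_coef_def coef_uminus)
    ultimately show ?thesis
      using V by (intro bexI[of _ ?W] inj) (simp_all add: simps)
  qed
  show "U \<oplus>\<^bsub>L F\<^esub> V \<oplus>\<^bsub>L F\<^esub> W = U \<oplus>\<^bsub>L F\<^esub> (V \<oplus>\<^bsub>L F\<^esub> W)"
    if "U \<in> carrier (L F)" "V \<in> carrier (L F)" "W \<in> carrier (L F)" for U V W
    using that by (intro inj ext) (simp_all add: simps)
  show "V \<oplus>\<^bsub>L F\<^esub> W = W \<oplus>\<^bsub>L F\<^esub> V" if "V \<in> carrier (L F)" "W \<in> carrier (L F)" for V W
    using that by (intro inj ext) (simp_all add: simps)
  show "\<zero>\<^bsub>L F\<^esub> \<oplus>\<^bsub>L F\<^esub> V = V" if "V \<in> carrier (L F)" for V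
    using that by (intro inj ext) (simp_all add: simps)
qed (use L_add_closed[OF assms] L_zero_closed[OF assms] in auto)

lemma val_uminus:
  assumes "F \<subseteq> {1..r}" "V \<in> carrier (L F)"
  shows "val F (\<ominus>\<^bsub>L F\<^esub> V) a = - val F V a"
proof -
  interpret L: abelian_group "L F"
    using assms(1) by (rule abelian_group_L)
  have "val F (\<ominus>\<^bsub>L F\<^esub> V) a + val F V a = val F (\<ominus>\<^bsub>L F\<^esub> V \<oplus>\<^bsub>L F\<^esub> V) a"
    using assms by (intro val_add[symmetric] L.a_inv_closed)
  then show ?thesis
    by (simp only: L.l_neg[OF assms(2)] val_zero[OF assms(1)] eq_neg_iff_add_eq_0)
qed

lemma sign_multiple:
  assumes "F \<subseteq> {1..r}" "V \<in> carrier (L F)"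
  shows sign_multiple_closed: "[((- 1 :: int) ^ n)] \<cdot>\<^bsub>L F\<^esub> V \<in> carrier (L F)"
    and val_sign_multiple: "val F ([((- 1 :: int) ^ n)] \<cdot>\<^bsub>L F\<^esub> V) a = (- 1) ^ n * val F V a"
proof -
  interpret L: abelian_group "L F"
    using assms(1) by (rule abelian_group_L)
  have "[(1::int)] \<cdot>\<^bsub>L F\<^esub> V = V" "[(- 1::int)] \<cdot>\<^bsub>L F\<^esub> V = \<ominus>\<^bsub>L F\<^esub> V"
    using assms(2) add_pow_int_ge[of 1 "L F" V] add_pow_int_lt[of "- 1" "L F" V]
    by (simp_all add: add_pow_def nat_pow_def)
  then show "[((- 1 :: int) ^ n)] \<cdot>\<^bsub>L F\<^esub> V \<in> carrier (L F)"
      "val F ([((- 1 :: int) ^ n)] \<cdot>\<^bsub>L F\<^esub> V) a = (- 1) ^ n * val F V a"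
    using assms by (cases "even n"; simp add: val_uminus)+
qed

lemma val_finsum:
  assumes "F \<subseteq> {1..r}" "finite A" "\<And>k. k \<in> A \<Longrightarrow> g k \<in> carrier (L F)"
  shows "val F (finsum (L F) g A) a = (\<Sum>k\<in>A. val F (g k) a)"
proof -
  interpret L: abelian_group "L F"
    using assms(1) by (rule abelian_group_L)
  show ?thesis
    using assms(2,3)
  proof (induction A rule: finite_induct)
    case empty
    then show ?case by (simp add: val_zero[OF assms(1)])
  next
    case (insert k A)
    then have "g \<in> A \<rightarrow> carrier (L F)"
      by auto
    then show ?case
      using insert by (simp add: val_add[OF assms(1)])
  qed
qed

text \<open>In coordinates the canonical map is restriction to \<open>degrees F\<close>. For
  \<open>a k \<ge> 0\<close> the \<open>m\<close>-th power of the variable supplies exactly the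
  \<open>m\<close> that \<open>expo\<close> adds at \<open>k\<close>. For \<open>a k < 0\<close>
  both sides vanish: the source has no such multidegree, and an entry \<open>a k + m\<close> below
  \<open>m\<close> is not reached by multiplication with that power.\<close>

lemma face_map_fraction:
  assumes "F \<subseteq> {1..r}" "k \<in> F" "X \<in> carrier R"
  shows "face_map R y F k (fraction R (den (F - {k})) X m) =
      fraction R (den F) (mon (Poly_Mapping.single k m) \<otimes>\<^bsub>R\<^esub> X) m"
    and "frac_coef F (mon (Poly_Mapping.single k m) \<otimes>\<^bsub>R\<^esub> X) m a =
      (if a \<in> degrees F then frac_coef (F - {k}) X m a else 0)"
proof -
  have k: "k \<in> {1..r}"
    using assms by blast
  have F': "F - {k} \<subseteq> {1..r}"
    using assms(1) by blast
  have single: "Poly_Mapping.single k N \<in> exponents r" for N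
    using k by (auto simp: exponents_def)
  have expo: "expo F N a = Poly_Mapping.single k N + expo (F - {k}) N a" if "0 \<le> a k" for N a
    using that k assms(2)
    by (intro poly_mapping_eqI) (auto simp: lookup_expo lookup_add lookup_single when_def nat_add_distrib)
  have fc: "frac_coef F (mon (Poly_Mapping.single k m) \<otimes>\<^bsub>R\<^esub> X) m a =
      (if a \<in> degrees F then frac_coef (F - {k}) X m a else 0)" if X: "X \<in> carrier R" for X m a
  proof (cases "a \<in> degrees F")
    case False
    then show ?thesis by (simp add: frac_coef_def)
  next
    case a: True
    show ?thesis
    proof (cases "0 \<le> a k")
      case True
      \<comment> \<open>Multiplication by the \<open>N\<close>-th power of the variable leads from
        \<open>expo (F - {k}) N a\<close> to \<open>expo F N a\<close>, and \<open>M\<close> is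
        closed upwards; hence \<open>a\<close> is also a multidegree of the smaller face.\<close>
      have "expo (F - {k}) N a \<notin> M" if "\<forall>l\<in>F - {k}. 0 \<le> a l + int N" for N
      proof
        assume "expo (F - {k}) N a \<in> M"
        then have "expo F N a \<in> M"
          using M_add[OF _ single] unfolding expo[where a = a, OF True] by (metis add.commute)
        moreover have "0 \<le> a l + int N" if "l \<in> F" for l
          using that True \<open>\<forall>l\<in>F - {k}. 0 \<le> a l + int N\<close> by (cases "l = k") auto
        ultimately show False
          using degreesD(3)[OF a] by blast
      qed
      then have a': "a \<in> degrees (F - {k})"
        using a True by (auto simp: degrees_def)
      have cond: "(\<forall>l\<in>F. 0 \<le> a l + int m) \<longleftrightarrow> (\<forall>l\<in>F - {k}. 0 \<le> a l + int m)"
        using True by auto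
      show ?thesis
      proof (cases "\<forall>l\<in>F. 0 \<le> a l + int m")
        case nn: True
        then have "expo F m a \<notin> M"
          using degreesD(3)[OF a] by blast
        then show ?thesis
          using a a' nn cond coef_mon_mult[OF single X, of m "expo (F - {k}) m a"]
          by (simp add: frac_coef_def expo[where a = a, OF True])
      next
        case False
        then show ?thesis
          using cond by (auto simp: frac_coef_def)
      qed
    next
      case False
      then have "a \<notin> degrees (F - {k})"
        using degreesD(2)[of a "F - {k}" k] by auto
      moreover have "coef (mon (Poly_Mapping.single k m) \<otimes>\<^bsub>R\<^esub> X) (expo F m a) = 0"
        if "0 \<le> a k + int m"
      proof (rule coef_mon_mult_eq_0[OF single X])
        show "\<nexists>b. expo F m a = Poly_Mapping.single k m + b"
        proof
          assume "\<exists>b. expo F m a = Poly_Mapping.single k m + b"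
          then obtain b where "Poly_Mapping.lookup (expo F m a) k = Poly_Mapping.lookup (Poly_Mapping.single k m + b) k"
            by auto
          then have "nat (a k + int m) \<ge> m"
            using assms(2) k by (simp add: lookup_expo lookup_add)
          then show False
            using False that by auto
        qed
      qed
      ultimately show ?thesis
        using assms(2) by (auto simp: frac_coef_def)
    qed
  qed
  then show "frac_coef F (mon (Poly_Mapping.single k m) \<otimes>\<^bsub>R\<^esub> X) m a =
      (if a \<in> degrees F then frac_coef (F - {k}) X m a else 0)"
    using assms(3) by blast
  have closed: "mon (Poly_Mapping.single k m) \<otimes>\<^bsub>R\<^esub> X \<in> carrier R" if "X \<in> carrier R" for X m
    using that mon_closed[OF single] by simp
  have "fraction R (den F) (mon (Poly_Mapping.single k m') \<otimes>\<^bsub>R\<^esub> X') m' =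
      fraction R (den F) (mon (Poly_Mapping.single k m) \<otimes>\<^bsub>R\<^esub> X) m"
    if "(X', m') \<in> fraction R (den (F - {k})) X m" for X' m'
  proof (rule fraction_eqI[OF assms(1) closed closed])
    show *: "X' \<in> carrier R" "X \<in> carrier R"
      using that assms(3) by (auto simp: fraction_eq[OF F'])
    show "frac_coef F (mon (Poly_Mapping.single k m') \<otimes>\<^bsub>R\<^esub> X') m' =
        frac_coef F (mon (Poly_Mapping.single k m) \<otimes>\<^bsub>R\<^esub> X) m"
      using that * by (intro ext) (simp add: fc fraction_eq[OF F'])
  qed
  then show "face_map R y F k (fraction R (den (F - {k})) X m) =
      fraction R (den F) (mon (Poly_Mapping.single k m) \<otimes>\<^bsub>R\<^esub> X) m"
    unfolding face_map_def y_pow[OF k] by (intro UN_pair_const[OF fraction_self[OF F' assms(3)]])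
qed

lemma face_map:
  assumes "F \<subseteq> {1..r}" "k \<in> F" "V \<in> carrier (L (F - {k}))"
  shows face_map_closed: "face_map R y F k V \<in> carrier (L F)"
    and val_face_map: "val F (face_map R y F k V) a = (if a \<in> degrees F then val (F - {k}) V a else 0)"
proof -
  obtain X m where X: "X \<in> carrier R" "V = fraction R (den (F - {k})) X m"
    using assms(3) by (rule carrier_L_E)
  have k: "k \<in> {1..r}" and F': "F - {k} \<subseteq> {1..r}"
    using assms(1,2) by blast+
  have single: "Poly_Mapping.single k m \<in> exponents r"
    using k by (auto simp: exponents_def)
  have closed: "mon (Poly_Mapping.single k m) \<otimes>\<^bsub>R\<^esub> X \<in> carrier R"
    using X(1) mon_closed[OF single] by simp
  show "face_map R y F k V \<in> carrier (L F)"
    unfolding X(2) face_map_fraction(1)[OF assms(1,2) X(1)] using closed by (rule fraction_closed)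
  show "val F (face_map R y F k V) a = (if a \<in> degrees F then val (F - {k}) V a else 0)"
    unfolding X(2) face_map_fraction(1)[OF assms(1,2) X(1)] val_fraction[OF assms(1) closed]
      val_fraction[OF F' X(1)] by (rule face_map_fraction(2)[OF assms(1,2) X(1)])
qed

section \<open>Supports and image of the coefficient functions\<close>

lemma val_in_degrees:
  assumes "F \<subseteq> {1..r}" "V \<in> carrier (L F)" "val F V a \<noteq> 0"
  shows "a \<in> degrees F"
proof -
  obtain X m where "X \<in> carrier R" "V = fraction R (den F) X m"
    using assms(2) by (rule carrier_L_E)
  then show ?thesis
    using assms(3) by (simp add: val_fraction[OF assms(1)] frac_coef_def split: if_splits)
qed

lemma finite_val:
  assumes "F \<subseteq> {1..r}" "V \<in> carrier (L F)"
  shows "finite {a. val F V a \<noteq> 0}"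
proof -
  obtain X m where X: "X \<in> carrier R" "V = fraction R (den F) X m"
    using assms(2) by (rule carrier_L_E)
  let ?D = "{a. frac_coef F X m a \<noteq> 0}"
  have "inj_on (expo F m) ?D"
    by (rule inj_onI) (auto simp: frac_coef_def intro: expo_inject split: if_splits)
  moreover have "expo F m ` ?D \<subseteq> {b. coef X b \<noteq> 0}"
    by (auto simp: frac_coef_def split: if_splits)
  ultimately have "finite ?D"
    using finite_coef[OF X(1)] inj_on_finite by blast
  then show ?thesis
    by (simp add: X(2) val_fraction[OF assms(1) X(1)])
qed

text \<open>The image of \<open>val\<close> consists of all finitely supported functions on
  \<open>degrees F\<close>. The exponents of the numerator are recorded so that its homogeneity can
  be read off from the support of \<open>g\<close>.\<close>

lemma val_surj:
  assumes F: "F \<subseteq> {1..r}" and fin: "finite {a. g a \<noteq> 0}" and deg: "\<And>a. g a \<noteq> 0 \<Longrightarrow> a \<in> degrees F"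
  obtains p m where "p \<in> carrier S" "val F (fraction R (den F) (cls p) m) = g"
    "\<And>b. b \<in> Poly_Mapping.keys p \<Longrightarrow> \<exists>a. g a \<noteq> 0 \<and> (\<forall>k\<in>F. 0 \<le> a k + int m) \<and> b = expo F m a"
proof -
  let ?D = "{a. g a \<noteq> 0}"
  \<comment> \<open>A crude bound for all entries in the finite support, so that a single
    denominator exponent \<open>m\<close> makes the entries in \<open>F\<close> nonnegative.\<close>
  define s where "s = (\<Sum>(a, k)\<in>?D \<times> F. \<bar>a k\<bar>)"
  define m where "m = nat s"
  have "finite F"
    using F finite_subset by blast
  have nn: "0 \<le> a k + int m" if "g a \<noteq> 0" "k \<in> F" for a k
  proof -
    have "(case (a, k) of (a, k) \<Rightarrow> \<bar>a k\<bar>) \<le> s"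
      unfolding s_def using that fin \<open>finite F\<close> by (intro member_le_sum) auto
    then show ?thesis
      unfolding m_def prod.case by linarith
  qed
  define p where "p = (\<Sum>a\<in>?D. Poly_Mapping.single (expo F m a) (g a))"
  have "Poly_Mapping.keys p \<subseteq> (\<Union>a\<in>?D. Poly_Mapping.keys (Poly_Mapping.single (expo F m a) (g a)))"
    unfolding p_def by (rule keys_sum)
  also have "\<dots> \<subseteq> expo F m ` ?D"
    by auto
  finally have keys_p: "Poly_Mapping.keys p \<subseteq> expo F m ` ?D" .
  then have p: "p \<in> carrier S"
    using expo_exponents by auto
  have "frac_coef F (cls p) m c = g c" for c
  proof (cases "c \<in> degrees F \<and> (\<forall>k\<in>F. 0 \<le> c k + int m)")
    case True
    then have "expo F m c \<notin> M"
      using degreesD(3) by blast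
    then have "frac_coef F (cls p) m c = Poly_Mapping.lookup p (expo F m c)"
      using True by (simp add: frac_coef_def coef_cls[OF p])
    also have "\<dots> = (\<Sum>a\<in>?D. if a = c then g a else 0)"
      unfolding p_def lookup_sum
    proof (rule sum.cong)
      fix a assume "a \<in> ?D"
      then have "expo F m a = expo F m c \<longleftrightarrow> a = c"
        using expo_inject[of a F c m] True deg nn by auto
      then show "Poly_Mapping.lookup (Poly_Mapping.single (expo F m a) (g a)) (expo F m c) = (if a = c then g a else 0)"
        by (auto simp: lookup_single when_def)
    qed simp
    also have "\<dots> = g c"
      using fin by simp
    finally show ?thesis .
  next
    case False
    then have "g c = 0"
      using deg nn by blast
    moreover have "frac_coef F (cls p) m c = 0"
      using False by (simp only: frac_coef_def if_False)
    ultimately show ?thesis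
      by simp
  qed
  then have "val F (fraction R (den F) (cls p) m) = g"
    by (simp add: val_fraction[OF F cls_closed[OF p]] ext)
  then show ?thesis
  proof (rule that[OF p])
    fix b assume "b \<in> Poly_Mapping.keys p"
    then obtain a where "g a \<noteq> 0" "b = expo F m a"
      using keys_p by blast
    then show "\<exists>a. g a \<noteq> 0 \<and> (\<forall>k\<in>F. 0 \<le> a k + int m) \<and> b = expo F m a"
      using nn by blast
  qed
qed

lemma val_surj':
  assumes "F \<subseteq> {1..r}" "finite {a. g a \<noteq> 0}" "\<And>a. g a \<noteq> 0 \<Longrightarrow> a \<in> degrees F"
  shows "\<exists>V\<in>carrier (L F). val F V = g"
  using val_surj[OF assms] fraction_closed cls_closed by metis

end

locale monomial_cech = monomial_quotient r M I
  for r :: nat and M and I :: "((nat \<Rightarrow>\<^sub>0 nat) \<Rightarrow>\<^sub>0 'k::field) set" +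
  fixes T :: "nat set"
  assumes T_subset: "T \<subseteq> {1..r}"
begin

abbreviation G :: "int \<Rightarrow> ((nat \<Rightarrow>\<^sub>0 nat) \<Rightarrow>\<^sub>0 'k) set set" where "G \<equiv> residue_grading r I T"

section \<open>Total degree in the variables from \<open>T\<close>\<close>

definition tdeg :: "(nat \<Rightarrow> int) \<Rightarrow> int" where "tdeg a = (\<Sum>t\<in>T. a t)"

lemma finite_T: "finite T"
  using T_subset finite_subset by blast

lemma degree_expo:
  assumes "F \<subseteq> T" "a \<in> degrees F" "\<forall>k\<in>F. 0 \<le> a k + int m"
  shows "int (\<Sum>t\<in>T. Poly_Mapping.lookup (expo F m a) t) = tdeg a + int m * int (card F)"
proof -
  have "int (\<Sum>t\<in>T. Poly_Mapping.lookup (expo F m a) t) = (\<Sum>t\<in>T. a t + (if t \<in> F then int m else 0))"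
    unfolding of_nat_sum
  proof (rule sum.cong)
    fix t assume "t \<in> T"
    then show "int (Poly_Mapping.lookup (expo F m a) t) = a t + (if t \<in> F then int m else 0)"
      using T_subset assms(3) degreesD(2)[OF assms(2), of t] by (auto simp: lookup_expo)
  qed simp
  also have "\<dots> = tdeg a + int m * int (card F)"
    using assms(1) finite_T
    by (simp add: sum.distrib tdeg_def sum.inter_restrict[symmetric] Int_absorb1)
  finally show ?thesis .
qed

text \<open>An arbitrary representative of \<open>V\<close> may carry terms of the wrong degree that
  vanish in the localization. The homogeneous numerator is therefore rebuilt from the function
  \<open>val F V\<close>, using only exponents that come from its support.\<close>

lemma localization_grading_iff:
  assumes "F \<subseteq> T" "V \<in> carrier (L F)"
  shows "V \<in> localization_grading R G (den F) (int (card F)) d \<longleftrightarrow> (\<forall>a. val F V a \<noteq> 0 \<longrightarrow> tdeg a = d)"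
proof
  have F: "F \<subseteq> {1..r}"
    using assms(1) T_subset by blast
  {
    assume "V \<in> localization_grading R G (den F) (int (card F)) d"
    then obtain p m where p: "p \<in> carrier S" "V = fraction R (den F) (cls p) m"
        "\<forall>b\<in>Poly_Mapping.keys p. int (\<Sum>t\<in>T. Poly_Mapping.lookup b t) = d + int m * int (card F)"
      unfolding localization_grading_def residue_grading_def by blast
    show "\<forall>a. val F V a \<noteq> 0 \<longrightarrow> tdeg a = d"
    proof (intro allI impI)
      fix a assume "val F V a \<noteq> 0"
      then have a: "a \<in> degrees F" "\<forall>k\<in>F. 0 \<le> a k + int m" "Poly_Mapping.lookup p (expo F m a) \<noteq> 0"
        by (auto simp: p(2) val_fraction[OF F cls_closed[OF p(1)]] frac_coef_def coef_cls[OF p(1)]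
            split: if_splits)
      then have "int (\<Sum>t\<in>T. Poly_Mapping.lookup (expo F m a) t) = d + int m * int (card F)"
        using p(3) by (simp add: in_keys_iff del: of_nat_sum)
      then show "tdeg a = d"
        using degree_expo[OF assms(1) a(1,2)] by linarith
    qed
  }
  assume hom: "\<forall>a. val F V a \<noteq> 0 \<longrightarrow> tdeg a = d"
  obtain p m where p: "p \<in> carrier S" "val F (fraction R (den F) (cls p) m) = val F V"
      "\<And>b. b \<in> Poly_Mapping.keys p \<Longrightarrow> \<exists>a. val F V a \<noteq> 0 \<and> (\<forall>k\<in>F. 0 \<le> a k + int m) \<and> b = expo F m a"
    using val_surj[OF F finite_val[OF F assms(2)] val_in_degrees[OF F assms(2)]] by blast
  have "V = fraction R (den F) (cls p) m"
    using val_inject[OF F assms(2) fraction_closed[OF cls_closed[OF p(1)]]] p(2) by simp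
  moreover have "int (\<Sum>t\<in>T. Poly_Mapping.lookup b t) = d + int m * int (card F)" if b: "b \<in> Poly_Mapping.keys p" for b
  proof -
    obtain a where a: "val F V a \<noteq> 0" "\<forall>k\<in>F. 0 \<le> a k + int m" "b = expo F m a"
      using p(3)[OF b] by blast
    show ?thesis
      unfolding a(3) degree_expo[OF assms(1) val_in_degrees[OF F assms(2) a(1)] a(2)]
      using hom a(1) by simp
  qed
  ultimately show "V \<in> localization_grading R G (den F) (int (card F)) d"
    using p(1) unfolding localization_grading_def residue_grading_def by blast
qed

section \<open>The Cech complex in multidegrees\<close>

abbreviation C :: "nat \<Rightarrow> (((nat \<Rightarrow>\<^sub>0 nat) \<Rightarrow>\<^sub>0 'k) set,
    nat set \<Rightarrow> (((nat \<Rightarrow>\<^sub>0 nat) \<Rightarrow>\<^sub>0 'k) set \<times> nat) set) module"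
  where "C i \<equiv> cech R y T i"

text \<open>The value 0 beyond the faces, in place of \<open>undefined\<close>, gives total
  functions on which sums and differences are pointwise.\<close>

definition cochain_val :: "nat \<Rightarrow> (nat set \<Rightarrow> (((nat \<Rightarrow>\<^sub>0 nat) \<Rightarrow>\<^sub>0 'k) set \<times> nat) set) \<Rightarrow>
    nat set \<Rightarrow> (nat \<Rightarrow> int) \<Rightarrow> 'k"
  where "cochain_val i c F a = (if F \<in> faces T i then val F (c F) a else 0)"

definition cochains :: "nat \<Rightarrow> (nat set \<Rightarrow> (nat \<Rightarrow> int) \<Rightarrow> 'k) set"
  where "cochains i = {g. (\<forall>F a. g F a \<noteq> 0 \<longrightarrow> F \<in> faces T i \<and> a \<in> degrees F) \<and> (\<forall>F. finite {a. g F a \<noteq> 0})}"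

text \<open>The test \<open>a \<in> degrees F\<close> is the face map, which in these coordinates is
  a restriction. Entries of different multidegrees never mix.\<close>

definition diff :: "nat \<Rightarrow> (nat set \<Rightarrow> (nat \<Rightarrow> int) \<Rightarrow> 'k) \<Rightarrow> nat set \<Rightarrow> (nat \<Rightarrow> int) \<Rightarrow> 'k"
  where "diff i g F a = (if F \<in> faces T (Suc i) \<and> a \<in> degrees F
    then \<Sum>k\<in>F. (- 1) ^ card {l \<in> F. l < k} * g (F - {k}) a else 0)"

fun bounds :: "nat \<Rightarrow> (nat set \<Rightarrow> (nat \<Rightarrow> int) \<Rightarrow> 'k) set"
  where "bounds 0 = {\<lambda>F a. 0}" | "bounds (Suc i) = diff i ` cochains i"

lemma facesD:
  assumes "F \<in> faces T i"
  shows "F \<subseteq> T" "F \<subseteq> {1..r}" "card F = i" "finite F"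
  using assms T_subset finite_T finite_subset by (auto simp: faces_def)

lemma faces_diff: "F \<in> faces T (Suc i) \<Longrightarrow> k \<in> F \<Longrightarrow> F - {k} \<in> faces T i"
  using facesD(4)[of F "Suc i"] by (auto simp: faces_def)

section \<open>Transport of the Cech complex to functions\<close>

lemma cech_simps:
  "carrier (C i) = (\<Pi>\<^sub>E F\<in>faces T i. carrier (L F))"
  "\<zero>\<^bsub>C i\<^esub> = (\<lambda>F\<in>faces T i. \<zero>\<^bsub>L F\<^esub>)"
  "c \<oplus>\<^bsub>C i\<^esub> c' = (\<lambda>F\<in>faces T i. c F \<oplus>\<^bsub>L F\<^esub> c' F)"
  by (simp_all add: cech_def)

lemma cech_mem: "c \<in> carrier (C i) \<Longrightarrow> F \<in> faces T i \<Longrightarrow> c F \<in> carrier (L F)"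
  by (auto simp: cech_simps)

lemma cochain_val_cochains:
  assumes "c \<in> carrier (C i)"
  shows "cochain_val i c \<in> cochains i"
proof -
  have "finite {a. cochain_val i c F a \<noteq> 0}" for F
  proof (cases "F \<in> faces T i")
    case True
    then show ?thesis
      using finite_val[OF facesD(2)[OF True] cech_mem[OF assms True]] by (simp add: cochain_val_def)
  qed (simp add: cochain_val_def)
  moreover have "F \<in> faces T i \<and> a \<in> degrees F" if "cochain_val i c F a \<noteq> 0" for F a
  proof -
    have F: "F \<in> faces T i" "val F (c F) a \<noteq> 0"
      using that by (auto simp: cochain_val_def split: if_splits)
    then show ?thesis
      using val_in_degrees[OF facesD(2)[OF F(1)] cech_mem[OF assms F(1)] F(2)] by blast
  qed
  ultimately show ?thesis
    by (simp add: cochains_def)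
qed

lemma cochain_val_inject:
  assumes "c \<in> carrier (C i)" "c' \<in> carrier (C i)" "cochain_val i c = cochain_val i c'"
  shows "c = c'"
proof (rule PiE_ext)
  show "c \<in> (\<Pi>\<^sub>E F\<in>faces T i. carrier (L F))" "c' \<in> (\<Pi>\<^sub>E F\<in>faces T i. carrier (L F))"
    using assms by (simp_all add: cech_simps)
  fix F assume F: "F \<in> faces T i"
  have "val F (c F) a = val F (c' F) a" for a
    using fun_cong[OF fun_cong[OF assms(3)], of F a] F by (simp add: cochain_val_def)
  then show "c F = c' F"
    using val_inject[OF facesD(2)[OF F] cech_mem[OF assms(1) F] cech_mem[OF assms(2) F]] by blast
qed

lemma cochain_val_surj:
  assumes "g \<in> cochains i"
  obtains c where "c \<in> carrier (C i)" "cochain_val i c = g"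
proof -
  have "\<exists>V\<in>carrier (L F). val F V = g F" if "F \<in> faces T i" for F
    using assms that by (intro val_surj' facesD(2)[OF that]) (auto simp: cochains_def)
  then obtain c where c: "\<And>F. F \<in> faces T i \<Longrightarrow> c F \<in> carrier (L F) \<and> val F (c F) = g F"
    by metis
  show ?thesis
  proof (rule that[of "restrict c (faces T i)"])
    show "restrict c (faces T i) \<in> carrier (C i)"
      using c by (simp add: cech_simps)
    show "cochain_val i (restrict c (faces T i)) = g"
      using c assms by (intro ext) (auto simp: cochain_val_def cochains_def)
  qed
qed

lemma cech_add:
  assumes "c \<in> carrier (C i)" "c' \<in> carrier (C i)"
  shows cech_add_closed: "c \<oplus>\<^bsub>C i\<^esub> c' \<in> carrier (C i)"
    and cochain_val_add: "cochain_val i (c \<oplus>\<^bsub>C i\<^esub> c') F a = cochain_val i c F a + cochain_val i c' F a"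
  using L_add_closed[OF facesD(2) cech_mem[OF assms(1)] cech_mem[OF assms(2)]]
    val_add[OF facesD(2) cech_mem[OF assms(1)] cech_mem[OF assms(2)]]
  by (auto simp: cech_simps cochain_val_def)

lemma cech_zero:
  shows cech_zero_closed: "\<zero>\<^bsub>C i\<^esub> \<in> carrier (C i)"
    and cochain_val_zero: "cochain_val i \<zero>\<^bsub>C i\<^esub> = (\<lambda>F a. 0)"
  using L_zero[OF facesD(2)] by (auto simp: cech_simps cochain_val_def fun_eq_iff)

lemma cech_diff:
  assumes "c \<in> carrier (C i)"
  shows cech_diff_closed: "cech_diff R y T i c \<in> carrier (C (Suc i))"
    and cochain_val_diff: "cochain_val (Suc i) (cech_diff R y T i c) = diff i (cochain_val i c)"
proof -
  have fm: "face_map R y F k (c (F - {k})) \<in> carrier (L F)"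
      "val F (face_map R y F k (c (F - {k}))) a = (if a \<in> degrees F then val (F - {k}) (c (F - {k})) a else 0)"
    if "F \<in> faces T (Suc i)" "k \<in> F" for F k a
    using face_map[OF facesD(2)[OF that(1)] that(2) cech_mem[OF assms faces_diff[OF that]]] by auto
  have summand: "[((- 1 :: int) ^ n)] \<cdot>\<^bsub>L F\<^esub> (face_map R y F k (c (F - {k}))) \<in> carrier (L F)"
      "val F ([((- 1 :: int) ^ n)] \<cdot>\<^bsub>L F\<^esub> (face_map R y F k (c (F - {k})))) a =
        (if a \<in> degrees F then (- 1) ^ n * cochain_val i c (F - {k}) a else 0)"
    if "F \<in> faces T (Suc i)" "k \<in> F" for F k a n
    using sign_multiple[OF facesD(2)[OF that(1)] fm(1)[OF that]] fm(2)[OF that] faces_diff[OF that]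
    by (auto simp: cochain_val_def)
  have "finsum (L F) (\<lambda>k. [((- 1 :: int) ^ card {l \<in> F. l < k})] \<cdot>\<^bsub>L F\<^esub> (face_map R y F k (c (F - {k})))) F \<in> carrier (L F)"
    if F: "F \<in> faces T (Suc i)" for F
  proof -
    interpret L: abelian_group "L F"
      using facesD(2)[OF F] by (rule abelian_group_L)
    show ?thesis
      using summand(1)[OF F] by (intro L.finsum_closed) auto
  qed
  then show "cech_diff R y T i c \<in> carrier (C (Suc i))"
    by (simp add: cech_simps cech_diff_def)
  show "cochain_val (Suc i) (cech_diff R y T i c) = diff i (cochain_val i c)"
  proof (intro ext)
    fix F a
    show "cochain_val (Suc i) (cech_diff R y T i c) F a = diff i (cochain_val i c) F a"
    proof (cases "F \<in> faces T (Suc i)")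
      case True
      then have "cochain_val (Suc i) (cech_diff R y T i c) F a =
          (\<Sum>k\<in>F. val F ([((- 1 :: int) ^ card {l \<in> F. l < k})] \<cdot>\<^bsub>L F\<^esub> (face_map R y F k (c (F - {k})))) a)"
        using val_finsum[OF facesD(2,4)[OF True] summand(1)[OF True]] by (simp add: cochain_val_def cech_diff_def)
      also have "\<dots> = diff i (cochain_val i c) F a"
        using True summand(2)[OF True] by (simp add: diff_def)
      finally show ?thesis .
    qed (simp add: cochain_val_def diff_def)
  qed
qed

lemma cocycles_eq: "cocycles R y T i = {c \<in> carrier (C i). diff i (cochain_val i c) = (\<lambda>F a. 0)}"
proof -
  have "cech_diff R y T i c = \<zero>\<^bsub>C (Suc i)\<^esub> \<longleftrightarrow> diff i (cochain_val i c) = (\<lambda>F a. 0)"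
    if "c \<in> carrier (C i)" for c
    using cochain_val_inject[OF cech_diff_closed[OF that] cech_zero_closed] cochain_val_diff[OF that] cochain_val_zero
    by metis
  then show ?thesis
    unfolding cocycles_def a_kernel_def' by blast
qed

text \<open>For positive \<open>i\<close> the inclusion from right to left rests on surjectivity of
  \<open>cochain_val\<close>, since a primitive found among functions has to come from a Cech
  cochain. For \<open>i = 0\<close> injectivity suffices.\<close>

lemma coboundaries_eq: "coboundaries R y T i = {c \<in> carrier (C i). cochain_val i c \<in> bounds i}"
proof (cases i)
  case 0
  have "c = \<zero>\<^bsub>C 0\<^esub>" if "c \<in> carrier (C 0)" "cochain_val 0 c = (\<lambda>F a. 0)" for c
    using that by (intro cochain_val_inject[OF _ cech_zero_closed]) (simp_all only: cochain_val_zero)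
  then show ?thesis
    unfolding 0 coboundaries.simps bounds.simps singleton_iff
    using cech_zero_closed[of 0] cochain_val_zero[of 0] by blast
next
  case (Suc j)
  show ?thesis
  proof
    show "coboundaries R y T i \<subseteq> {c \<in> carrier (C i). cochain_val i c \<in> bounds i}"
    proof
      fix c assume "c \<in> coboundaries R y T i"
      then obtain b where b: "b \<in> carrier (C j)" "c = cech_diff R y T j b"
        by (auto simp only: Suc coboundaries.simps)
      then show "c \<in> {c \<in> carrier (C i). cochain_val i c \<in> bounds i}"
        using cech_diff[OF b(1)] cochain_val_cochains[OF b(1)] by (simp add: Suc)
    qed
    show "{c \<in> carrier (C i). cochain_val i c \<in> bounds i} \<subseteq> coboundaries R y T i"
    proof
      fix c assume "c \<in> {c \<in> carrier (C i). cochain_val i c \<in> bounds i}"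
      then obtain g where c: "c \<in> carrier (C (Suc j))" "cochain_val (Suc j) c = diff j g" "g \<in> cochains j"
        unfolding Suc bounds.simps by blast
      obtain b where b: "b \<in> carrier (C j)" "cochain_val j b = g"
        using c(3) by (rule cochain_val_surj)
      have "c = cech_diff R y T j b"
        using cech_diff[OF b(1)] by (intro cochain_val_inject[OF c(1)]) (simp_all only: b(2) c(2))
      then show "c \<in> coboundaries R y T i"
        using b(1) by (simp add: Suc)
    qed
  qed
qed

section \<open>Coboundaries as a subgroup\<close>

lemma cochains_diff:
  assumes "g \<in> cochains i" "h \<in> cochains i"
  shows "(\<lambda>F a. g F a - h F a) \<in> cochains i"
proof -
  have "finite {a. g F a - h F a \<noteq> 0}" for F
  proof (rule finite_subset)
    show "{a. g F a - h F a \<noteq> 0} \<subseteq> {a. g F a \<noteq> 0} \<union> {a. h F a \<noteq> 0}"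
      by auto
  qed (use assms in \<open>simp add: cochains_def\<close>)
  moreover have "F \<in> faces T i \<and> a \<in> degrees F" if "g F a - h F a \<noteq> 0" for F a
    using that assms by (cases "g F a = 0") (auto simp: cochains_def)
  ultimately show ?thesis
    by (simp add: cochains_def)
qed

lemma diff_minus: "diff i (\<lambda>F a. g F a - h F a) F a = diff i g F a - diff i h F a"
  by (simp add: diff_def right_diff_distrib sum_subtractf)

lemma bounds_zero: "(\<lambda>F a. 0) \<in> bounds i"
proof (cases i)
  case (Suc j)
  have "(\<lambda>F a. 0) = diff j (\<lambda>F a. 0)" "(\<lambda>F a. 0) \<in> cochains j"
    by (auto simp: fun_eq_iff diff_def cochains_def)
  then show ?thesis
    unfolding Suc bounds.simps by (rule image_eqI)
qed simp

lemma bounds_diff: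
  assumes "g \<in> bounds i" "h \<in> bounds i"
  shows "(\<lambda>F a. g F a - h F a) \<in> bounds i"
proof (cases i)
  case 0
  then show ?thesis using assms by simp
next
  case (Suc j)
  then obtain u v where *: "u \<in> cochains j" "v \<in> cochains j" "g = diff j u" "h = diff j v"
    using assms by auto
  then have "(\<lambda>F a. g F a - h F a) = diff j (\<lambda>F a. u F a - v F a)"
    by (simp add: diff_minus fun_eq_iff)
  then show ?thesis
    using cochains_diff[OF *(1,2)] unfolding Suc bounds.simps by (rule image_eqI)
qed

lemma bounds_add:
  assumes "g \<in> bounds i" "h \<in> bounds i"
  shows "(\<lambda>F a. g F a + h F a) \<in> bounds i"
  using bounds_diff[OF assms(1) bounds_diff[OF bounds_zero assms(2)]] by simp

text \<open>The usual coset criterion. The difference of \<open>x\<close> and \<open>z\<close> is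
  formed among functions and lifted back to a cochain \<open>b\<close>.\<close>

lemma coset_eq_coboundaries_iff:
  assumes z: "z \<in> carrier (C i)"
  shows "coboundaries R y T i +>\<^bsub>cocycle_module R y T i\<^esub> z = coboundaries R y T i \<longleftrightarrow>
    z \<in> coboundaries R y T i"
proof -
  let ?B = "coboundaries R y T i"
  have coset: "?B +>\<^bsub>cocycle_module R y T i\<^esub> z = (\<lambda>b. b \<oplus>\<^bsub>C i\<^esub> z) ` ?B"
    by (auto simp: a_r_coset_def' cocycle_module_def)
  show ?thesis
  proof
    assume eq: "?B +>\<^bsub>cocycle_module R y T i\<^esub> z = ?B"
    have B0: "\<zero>\<^bsub>C i\<^esub> \<in> ?B"
      by (simp add: coboundaries_eq cech_zero_closed cochain_val_zero bounds_zero)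
    then have "\<zero>\<^bsub>C i\<^esub> \<oplus>\<^bsub>C i\<^esub> z \<in> ?B"
      using eq unfolding coset by blast
    moreover have "\<zero>\<^bsub>C i\<^esub> \<oplus>\<^bsub>C i\<^esub> z = z"
      using z cech_zero_closed
      by (intro cochain_val_inject[of _ i] cech_add_closed ext) (simp_all add: cochain_val_add cochain_val_zero)
    ultimately show "z \<in> ?B"
      by simp
  next
    assume zB: "z \<in> ?B"
    show "?B +>\<^bsub>cocycle_module R y T i\<^esub> z = ?B"
      unfolding coset
    proof
      show "(\<lambda>b. b \<oplus>\<^bsub>C i\<^esub> z) ` ?B \<subseteq> ?B"
      proof (rule image_subsetI)
        fix b assume b: "b \<in> ?B"
        have "cochain_val i (b \<oplus>\<^bsub>C i\<^esub> z) = (\<lambda>F a. cochain_val i b F a + cochain_val i z F a)"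
          using b z by (intro ext cochain_val_add) (simp_all add: coboundaries_eq)
        then show "b \<oplus>\<^bsub>C i\<^esub> z \<in> ?B"
          using b zB z bounds_add by (simp add: coboundaries_eq cech_add_closed)
      qed
      show "?B \<subseteq> (\<lambda>b. b \<oplus>\<^bsub>C i\<^esub> z) ` ?B"
      proof
        fix x assume x: "x \<in> ?B"
        let ?g = "\<lambda>F a. cochain_val i x F a - cochain_val i z F a"
        have "?g \<in> cochains i"
          using x z by (intro cochains_diff cochain_val_cochains) (simp_all add: coboundaries_eq)
        then obtain b where b: "b \<in> carrier (C i)" "cochain_val i b = ?g"
          by (rule cochain_val_surj)
        have "b \<in> ?B"
          using b x zB bounds_diff by (simp add: coboundaries_eq)
        moreover have "x = b \<oplus>\<^bsub>C i\<^esub> z"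
          using x b z by (intro cochain_val_inject[of _ i] cech_add_closed ext)
            (simp_all add: coboundaries_eq cochain_val_add)
        ultimately show "x \<in> (\<lambda>b. b \<oplus>\<^bsub>C i\<^esub> z) ` ?B"
          by blast
      qed
    qed
  qed
qed

section \<open>Homogeneous components of the cohomology\<close>

lemma cech_grading_iff:
  assumes "c \<in> carrier (C i)"
  shows "c \<in> cech_grading R G y T i d \<longleftrightarrow> (\<forall>F a. cochain_val i c F a \<noteq> 0 \<longrightarrow> tdeg a = d)"
proof -
  have "c \<in> cech_grading R G y T i d \<longleftrightarrow> (\<forall>F\<in>faces T i. c F \<in> localization_grading R G (den F) (int i) d)"
    using assms by (auto simp: cech_grading_def cech_simps PiE_iff)
  also have "\<dots> \<longleftrightarrow> (\<forall>F\<in>faces T i. \<forall>a. val F (c F) a \<noteq> 0 \<longrightarrow> tdeg a = d)"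
    using localization_grading_iff[OF facesD(1) cech_mem[OF assms]] facesD(3) by auto
  finally show ?thesis
    by (auto simp: cochain_val_def)
qed

definition graded_cocycles :: "nat \<Rightarrow> int \<Rightarrow> (nat set \<Rightarrow> (nat \<Rightarrow> int) \<Rightarrow> 'k) set"
  where "graded_cocycles i d = {g \<in> cochains i. diff i g = (\<lambda>F a. 0) \<and> (\<forall>F a. g F a \<noteq> 0 \<longrightarrow> tdeg a = d)}"

text \<open>With this, the vanishing of a component is a question about functions on multidegrees.
  The primitives behind \<open>bounds i\<close> are not asked to be homogeneous.\<close>

lemma local_cohomology_grading_trivial_iff:
  "local_cohomology_grading R G y T i d = {\<zero>\<^bsub>local_cohomology R y T i\<^esub>} \<longleftrightarrow> graded_cocycles i d \<subseteq> bounds i"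
proof -
  let ?B = "coboundaries R y T i" and ?Z = "cocycles R y T i \<inter> cech_grading R G y T i d"
  have zero: "\<zero>\<^bsub>local_cohomology R y T i\<^esub> = ?B"
    by (simp add: local_cohomology_def Let_def)
  have Z: "z \<in> ?Z \<longleftrightarrow> cochain_val i z \<in> graded_cocycles i d" if "z \<in> carrier (C i)" for z
    using that cech_grading_iff[OF that] cochain_val_cochains[OF that]
    by (auto simp: cocycles_eq graded_cocycles_def)
  have Z_carrier: "?Z \<subseteq> carrier (C i)"
    by (auto simp: cocycles_eq)
  \<comment> \<open>The zero cochain is homogeneous of every degree, so the set of cosets is
    nonempty; it is then trivial exactly when each of its cosets is.\<close>
  have "\<zero>\<^bsub>C i\<^esub> \<in> ?Z"
    using Z[OF cech_zero_closed]
    by (simp add: cochain_val_zero graded_cocycles_def cochains_def diff_def fun_eq_iff)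
  then have "local_cohomology_grading R G y T i d = {?B} \<longleftrightarrow>
      (\<forall>z\<in>?Z. ?B +>\<^bsub>cocycle_module R y T i\<^esub> z = ?B)"
    unfolding local_cohomology_grading_def by blast
  also have "\<dots> \<longleftrightarrow> (\<forall>z\<in>?Z. z \<in> ?B)"
    using coset_eq_coboundaries_iff Z_carrier by blast
  also have "\<dots> \<longleftrightarrow> graded_cocycles i d \<subseteq> bounds i"
  proof
    assume ZB: "\<forall>z\<in>?Z. z \<in> ?B"
    show "graded_cocycles i d \<subseteq> bounds i"
    proof
      fix g assume g: "g \<in> graded_cocycles i d"
      then have "g \<in> cochains i"
        by (simp add: graded_cocycles_def)
      then obtain c where "c \<in> carrier (C i)" "cochain_val i c = g"
        by (rule cochain_val_surj)
      then show "g \<in> bounds i"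
        using ZB Z g by (auto simp: coboundaries_eq)
    qed
  next
    assume "graded_cocycles i d \<subseteq> bounds i"
    then show "\<forall>z\<in>?Z. z \<in> ?B"
      using Z Z_carrier by (auto simp: coboundaries_eq)
  qed
  finally show ?thesis
    by (simp only: zero)
qed

section \<open>Tameness\<close>

text \<open>For \<open>k\<close> outside \<open>F\<close> a negative entry excludes both
  multidegrees. For \<open>k\<close> in \<open>F\<close> the variable is invertible in the
  localization, and upward closure of \<open>M\<close> shows on exponents that the shift loses
  nothing in either direction.\<close>

lemma degrees_shift:
  assumes "F \<subseteq> {1..r}" "a k < 0"
  shows "a(k := a k - 1) \<in> degrees F \<longleftrightarrow> a \<in> degrees F" (is "?a' \<in> _ \<longleftrightarrow> _")
proof (cases "k \<in> F")
  case False
  then show ?thesis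
    using degreesD(2)[of a F k] degreesD(2)[of ?a' F k] assms(2) by fastforce
next
  case True
  then have k: "k \<in> {1..r}"
    using assms(1) by blast
  have "finite F"
    using assms(1) finite_subset by blast
  \<comment> \<open>Over the denominator exponent \<open>Suc N\<close> the shifted multidegree has
    at \<open>k\<close> the entry of \<open>a\<close> over \<open>N\<close>, and one more at every
    other index of \<open>F\<close>. Upward closure of \<open>M\<close> absorbs this
    surplus.\<close>
  have 1: "expo F N a \<notin> M" if a': "?a' \<in> degrees F" and nn: "\<forall>l\<in>F. 0 \<le> a l + int N" for N
  proof
    assume "expo F N a \<in> M"
    then have "expo F N a + face_exp (F - {k}) 1 \<in> M"
      using assms(1) by (intro M_add face_exp_exponents) auto
    moreover have "expo F N a + face_exp (F - {k}) 1 = expo F (Suc N) ?a'"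
    proof (rule poly_mapping_eqI)
      fix l
      show "Poly_Mapping.lookup (expo F N a + face_exp (F - {k}) 1) l = Poly_Mapping.lookup (expo F (Suc N) ?a') l"
      proof (cases "l \<in> F")
        case l: True
        then have "0 \<le> a l + int N" "l \<in> {1..r}"
          using nn assms(1) by blast+
        then show ?thesis
          using l \<open>finite F\<close> by (simp add: lookup_expo lookup_add lookup_face_exp) arith
      next
        case l: False
        then have "l \<noteq> k"
          using True by blast
        then show ?thesis
          using l \<open>finite F\<close> by (simp add: lookup_expo lookup_add lookup_face_exp)
      qed
    qed
    moreover have "expo F (Suc N) ?a' \<notin> M"
    proof (rule degreesD(3)[OF a'])
      fix l assume "l \<in> F"
      then show "0 \<le> ?a' l + int (Suc N)"
        using bspec[OF nn] by fastforce
    qed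
    ultimately show False
      by simp
  qed
  \<comment> \<open>In the other direction one factor of the variable \<open>k\<close> leads from
    \<open>?a'\<close> to \<open>a\<close> over the same denominator exponent.\<close>
  have 2: "expo F N ?a' \<notin> M" if a: "a \<in> degrees F" and nn: "\<forall>l\<in>F. 0 \<le> ?a' l + int N" for N
  proof
    assume "expo F N ?a' \<in> M"
    then have "expo F N ?a' + Poly_Mapping.single k 1 \<in> M"
      using k by (intro M_add) (auto simp: exponents_def)
    moreover have "expo F N ?a' + Poly_Mapping.single k 1 = expo F N a"
      using True k bspec[OF nn True]
      by (intro poly_mapping_eqI) (auto simp: lookup_expo lookup_add lookup_single when_def)
    moreover have "0 \<le> a l + int N" if "l \<in> F" for l
      using bspec[OF nn that] by (simp split: if_splits)
    then have "expo F N a \<notin> M"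
      by (rule degreesD(3)[OF a])
    ultimately show False
      by simp
  qed
  have 3: "l \<noteq> k" if "l \<notin> {1..r} \<or> l \<notin> F" for l
    using k True that by blast
  show ?thesis
  proof
    assume a': "?a' \<in> degrees F"
    have "a l = 0" if "l \<notin> {1..r}" for l
      using degreesD(1)[OF a' that] 3[of l] that by simp
    moreover have "0 \<le> a l" if "l \<notin> F" for l
      using degreesD(2)[OF a' that] 3[of l] that by simp
    ultimately show "a \<in> degrees F"
      using 1[OF a'] unfolding degrees_def by blast
  next
    assume a: "a \<in> degrees F"
    have "?a' l = 0" if "l \<notin> {1..r}" for l
      using degreesD(1)[OF a that] 3[of l] that by simp
    moreover have "0 \<le> ?a' l" if "l \<notin> F" for l
      using degreesD(2)[OF a that] 3[of l] that by simp
    ultimately show "?a' \<in> degrees F"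
      using 2[OF a] unfolding degrees_def by blast
  qed
qed

lemma tdeg_update: "k \<in> T \<Longrightarrow> tdeg (a(k := b)) = tdeg a - a k + b"
  using finite_T by (simp add: tdeg_def sum.remove[of T k])

text \<open>
  A cocycle of degree \<open>j < 0\<close> is split according to a variable in which the multidegree is
  negative. Dividing a part by its variable gives a cocycle of degree \<open>j - 1\<close>; bounds of these,
  multiplied back, add up to a bound of the given cocycle.
\<close>

lemma graded_cocycles_step:
  assumes "j < 0" and IH: "graded_cocycles i (j - 1) \<subseteq> bounds i"
  shows "graded_cocycles i j \<subseteq> bounds i"
proof
  fix g assume g: "g \<in> graded_cocycles i j"
  then have gC: "g \<in> cochains i" and g0: "\<And>F a. diff i g F a = 0"
    and gdeg: "\<And>F a. g F a \<noteq> 0 \<Longrightarrow> tdeg a = j"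
    by (auto simp: graded_cocycles_def)
  have gsupp: "F \<in> faces T i" "a \<in> degrees F" if "g F a \<noteq> 0" for F a
    using that gC by (auto simp: cochains_def)
  \<comment> \<open>The variable depends on the multidegree and not on the face, so the choice is
    compatible with the differential.\<close>
  define v where "v a = (SOME k. k \<in> T \<and> a k < 0)" for a :: "nat \<Rightarrow> int"
  have v: "v a \<in> T" "a (v a) < 0" if "tdeg a = j" for a
  proof -
    have "\<exists>k. k \<in> T \<and> a k < 0"
    proof (rule ccontr)
      assume "\<nexists>k. k \<in> T \<and> a k < 0"
      then have "0 \<le> tdeg a"
        unfolding tdeg_def by (intro sum_nonneg) force
      then show False
        using that assms(1) by simp
    qed
    then have "v a \<in> T \<and> a (v a) < 0"
      unfolding v_def by (rule someI_ex)
    then show "v a \<in> T" "a (v a) < 0"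
      by auto
  qed
  \<comment> \<open>The part of \<open>g\<close> with negative entry at \<open>k\<close>, divided by
    the variable \<open>k\<close>. The bound \<open>- 1\<close> keeps the entry negative after
    adding 1, so that \<open>degrees_shift\<close> applies on every face. The parts for different
    \<open>k\<close> may overlap.\<close>
  define w where "w k F a = (if a k < - 1 then g F (a(k := a k + 1)) else 0)" for k F and a :: "nat \<Rightarrow> int"
  have shift: "a(k := a k + 1) \<in> degrees F \<longleftrightarrow> a \<in> degrees F" if "a k < - 1" "F \<subseteq> {1..r}" for a k F
    using degrees_shift[of F "a(k := a k + 1)" k] that by simp
  have w: "w k \<in> bounds i" if k: "k \<in> T" for k
  proof -
    have "w k \<in> cochains i"
      unfolding cochains_def
    proof (intro CollectI conjI allI impI)
      fix F a assume "w k F a \<noteq> 0"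
      then have "a k < - 1" "g F (a(k := a k + 1)) \<noteq> 0"
        by (auto simp: w_def split: if_splits)
      then show "F \<in> faces T i" "a \<in> degrees F"
        using gsupp shift[of a k F] facesD(2) by blast+
    next
      fix F
      have "{a. w k F a \<noteq> 0} \<subseteq> (\<lambda>a. a(k := a k - 1)) ` {a. g F a \<noteq> 0}"
      proof
        fix a assume "a \<in> {a. w k F a \<noteq> 0}"
        then have "g F (a(k := a k + 1)) \<noteq> 0"
          by (auto simp: w_def split: if_splits)
        then show "a \<in> (\<lambda>a. a(k := a k - 1)) ` {a. g F a \<noteq> 0}"
          by (intro image_eqI[of _ _ "a(k := a k + 1)"]) simp_all
      qed
      moreover have "finite {a. g F a \<noteq> 0}"
        using gC by (simp add: cochains_def)
      ultimately show "finite {a. w k F a \<noteq> 0}"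
        using finite_subset by blast
    qed
    \<comment> \<open>The cut at \<open>- 1\<close> ignores the face. Below it the differential is
      that of \<open>g\<close> at the shifted multidegree; elsewhere all summands are 0.\<close>
    moreover have "diff i (w k) F a = 0" for F a
    proof (cases "F \<in> faces T (Suc i) \<and> a \<in> degrees F \<and> a k < - 1")
      case True
      then have "a(k := a k + 1) \<in> degrees F"
        using shift facesD(2) by blast
      then have "diff i (w k) F a = diff i g F (a(k := a k + 1))"
        using True by (simp add: diff_def w_def)
      then show ?thesis
        by (simp add: g0)
    qed (auto simp: diff_def w_def)
    moreover have "tdeg a = j - 1" if "w k F a \<noteq> 0" for F a
      using that gdeg[of F "a(k := a k + 1)"] tdeg_update[OF k, of a "a k + 1"]
      by (simp add: w_def split: if_splits)
    ultimately have "w k \<in> graded_cocycles i (j - 1)"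
      by (simp add: graded_cocycles_def fun_eq_iff)
    then show ?thesis
      using IH by blast
  qed
  \<comment> \<open>The entry at \<open>v a\<close> is negative, hence below \<open>- 1\<close>
    after the shift, and escapes the cut in \<open>w\<close>.\<close>
  have w_unshift: "w (v a) F (a(v a := a (v a) - 1)) = g F a" if "tdeg a = j" for F a
    using v(2)[OF that] by (simp add: w_def)
  show "g \<in> bounds i"
  proof (cases i)
    case 0
    \<comment> \<open>In cohomological degree 0 the only bound is 0, so \<open>w\<close> vanishes
      and with it \<open>g\<close>.\<close>
    have "g F a = 0" for F a
    proof (cases "tdeg a = j")
      case True
      then show ?thesis
        using w[OF v(1)[OF True]] w_unshift[OF True, of F] by (simp add: 0)
    qed (use gdeg in blast)
    then show ?thesis
      by (simp add: 0 fun_eq_iff)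
  next
    case (Suc l)
    have "\<forall>k\<in>T. \<exists>u. u \<in> cochains l \<and> w k = diff l u"
      using w by (auto simp: Suc)
    then obtain u where u: "\<And>k. k \<in> T \<Longrightarrow> u k \<in> cochains l" "\<And>k. k \<in> T \<Longrightarrow> w k = diff l (u k)"
      by metis
    \<comment> \<open>Each multidegree uses only the primitive of its own variable, which resolves
      the overlaps. The cut to total degree \<open>j\<close> keeps \<open>v a\<close> meaningful and
      drops whatever else the primitives contain.\<close>
    define h where "h F a = (if tdeg a = j then u (v a) F (a(v a := a (v a) - 1)) else 0)" for F a
    have "h \<in> cochains l"
      unfolding cochains_def
    proof (intro CollectI conjI allI impI)
      fix F a assume "h F a \<noteq> 0"
      then have *: "tdeg a = j" "u (v a) F (a(v a := a (v a) - 1)) \<noteq> 0"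
        by (auto simp: h_def split: if_splits)
      then have **: "F \<in> faces T l" "a(v a := a (v a) - 1) \<in> degrees F"
        using u(1)[OF v(1)] by (auto simp: cochains_def)
      show "F \<in> faces T l"
        by (rule **)
      show "a \<in> degrees F"
        using **(2) degrees_shift[where a = a and k = "v a", OF facesD(2)[OF **(1)] v(2)[OF *(1)]] by blast
    next
      fix F
      \<comment> \<open>The variable changes with \<open>a\<close>, so the support is bounded by a
        union over all of \<open>T\<close>, which is finite.\<close>
      have "{a. h F a \<noteq> 0} \<subseteq> (\<Union>k\<in>T. (\<lambda>a. a(k := a k + 1)) ` {a. u k F a \<noteq> 0})"
      proof
        fix a assume "a \<in> {a. h F a \<noteq> 0}"
        then have *: "tdeg a = j" "u (v a) F (a(v a := a (v a) - 1)) \<noteq> 0"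
          by (auto simp: h_def split: if_splits)
        then have "a \<in> (\<lambda>b. b(v a := b (v a) + 1)) ` {b. u (v a) F b \<noteq> 0}"
          by (intro image_eqI[of _ _ "a(v a := a (v a) - 1)"]) simp_all
        then show "a \<in> (\<Union>k\<in>T. (\<lambda>a. a(k := a k + 1)) ` {a. u k F a \<noteq> 0})"
          using v(1)[OF *(1)] by blast
      qed
      moreover have "finite (\<Union>k\<in>T. (\<lambda>a. a(k := a k + 1)) ` {a. u k F a \<noteq> 0})"
        using u(1) finite_T by (intro finite_UN_I finite_imageI) (auto simp: cochains_def)
      ultimately show "finite {a. h F a \<noteq> 0}"
        by (rule finite_subset)
    qed
    moreover have "g = diff l h"
    proof (intro ext)
      fix F a
      show "g F a = diff l h F a"
      proof (cases "tdeg a = j")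
        case True
        \<comment> \<open>All faces \<open>F - {k}\<close> read the same primitive
          \<open>u (v a)\<close> at the same shifted multidegree, and \<open>degrees_shift\<close>
          matches the tests for \<open>F\<close> itself.\<close>
        have "diff l h F a = diff l (u (v a)) F (a(v a := a (v a) - 1))"
        proof (cases "F \<in> faces T (Suc l)")
          case F: True
          show ?thesis
            using True degrees_shift[where a = a and k = "v a", OF facesD(2)[OF F] v(2)[OF True]] by (simp add: diff_def h_def)
        qed (simp add: diff_def)
        also have "\<dots> = g F a"
          using w_unshift[OF True] u(2)[OF v(1)[OF True]] by simp
        finally show ?thesis ..
      next
        case False
        then have "diff l h F a = 0"
          by (simp add: diff_def h_def)
        then show ?thesis
          using gdeg False by metis
      qed
    qed
    ultimately show ?thesis
      by (simp add: Suc)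
  qed
qed

text \<open>The threshold is \<open>- 1\<close> if all negative degrees vanish; otherwise it is any
  negative degree with a nonzero component, from which the contrapositive of the step
  descends.\<close>

lemma local_cohomology_tame:
  "tame (local_cohomology R y T i) (local_cohomology_grading R G y T i)"
proof (cases "\<forall>j\<le>- 1. graded_cocycles i j \<subseteq> bounds i")
  case True
  then show ?thesis
    unfolding tame_def local_cohomology_grading_trivial_iff by blast
next
  case False
  then obtain j0 where j0: "j0 \<le> - 1" "\<not> graded_cocycles i j0 \<subseteq> bounds i"
    by blast
  have "\<not> graded_cocycles i j \<subseteq> bounds i" if "j \<le> j0" for j
    using that
  proof (induction j rule: int_le_induct)
    case base
    then show ?case by (rule j0)
  next
    case (step j)
    then show ?case using graded_cocycles_step[of j i] j0(1) by linarith
  qed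
  then show ?thesis
    unfolding tame_def local_cohomology_grading_trivial_iff by blast
qed

end

theorem corollary2p7:
  fixes r i :: nat
    and I :: "((nat \<Rightarrow>\<^sub>0 nat) \<Rightarrow>\<^sub>0 'k::field) set"
    and P :: "((nat \<Rightarrow>\<^sub>0 nat) \<Rightarrow>\<^sub>0 'k) set set"
    and T :: "nat set"
  assumes "monomial_ideal r I"
    and "primeideal P (poly_ring r Quot I)"
    and "T \<subseteq> {1..r}"
    and "P = genideal (poly_ring r Quot I) (residue_var r I ` T)"
  shows "tame (local_cohomology (poly_ring r Quot I) (residue_var r I) T i)
    (local_cohomology_grading (poly_ring r Quot I) (residue_grading r I T) (residue_var r I) T i)"
proof -
  obtain M where "M \<subseteq> exponents r" "\<And>a b. a \<in> M \<Longrightarrow> b \<in> exponents r \<Longrightarrow> a + b \<in> M"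
      "I = {p. Poly_Mapping.keys p \<subseteq> M}"
    using monomial_ideal_span[OF assms(1)] by blast
  then interpret monomial_cech r M I T
    using assms(3) by unfold_locales
  show ?thesis
    by (rule local_cohomology_tame)
qed

end
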